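(* Let $m>2$, suppose that the random vector $X_0\in\mathbb{R}^p$ is weakly $m$-th order isotropic with constant $C_m$ and that the entries of $X_0$ are Bernstein with constants $\sigma_X$ and $K_X$. Let $S\subset\{1,\ldots,p\}$ be non-empty, $s:=|S|$ and $L\ge0$, with $\phi_0(L,S)>0$ and $\kappa_0(L,S)>0$. For $M>0$ and $t>0$ let $$\Delta_n^{\rm L}(M,t):=D_m\left(16M\delta_n+\sqrt{\frac{2t}{n}}\right)^{\frac{m-2}{m-1}}+\frac{8D_m^2}{3}\left(\frac tn\right)^{\frac{m-2}{m-1}},$$ $$D_m := [2C_m]^{\frac{m}{m-1}}\,\frac{m-1}{m-2},\qquad \delta_n:=\sigma_X\sqrt{\frac{2\log(2p)}{n}}+K_X\frac{\log(2p)}{n}.$$ Then for all $t>0$, with probability at least $1-\exp[-t]$, $$\frac{\hat\phi^2(L,S)}{\phi_0^2(L,S)}-1\ \ge\ -\Delta_n^{\rm L}\big((L+1)\sqrt s/\phi_0(L,S),\,t\big)$$ as well as $$\frac{\hat\kappa^2(L,S)}{\kappa_0^2(L,S)}-1\ \ge\ -\Delta_n^{\rm L}\big((L+1)\sqrt s/\kappa_0(L,S),\,t\big).$$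
   Context: $X$ is an $n\times p$ random matrix whose rows are i.i.d. copies of $X_0^T$, where $X_0$ is a random vector in $\mathbb{R}^p$ for which $\Sigma_0:=\mathbb{E}X_0X_0^T$ exists. $\hat\Sigma:=X^TX/n$. For a real random variable $Z$, $\|Z\|_m:=(\mathbb{E}|Z|^m)^{1/m}$; thus $\|X_0^Tu\|_2^2=u^T\Sigma_0u$. For $u\in\mathbb{R}^p$, $\|u\|_q$ is the $\ell_q$-norm, $u_S$ is the vector with entries $u_j1\{j\in S\}$, and $u_{-S}:=u-u_S$. Weak isotropy: $X_0$ is weakly $m$-th order isotropic with constant $C_m$ if for all $u\in\mathbb{R}^p$ with $\|X_0^Tu\|_2=1$ one has $\mathbb{P}(|X_0^Tu|>t)\le (C_m/t)^m$ for all $t>0$. Bernstein: a real random variable $Z$ is Bernstein with constants $\sigma$ and $K$ if $\mathbb{E}|Z|^k\le\frac{k!}{2}K^{k-2}\sigma^2$ for all $k\in\{2,3,\ldots\}$. Empirical and theoretical compatibility constants (nonnegative square roots of): $$\hat\phi^2(L,S):=\min\{s\,u^T\hat\Sigma u:\ \|u_S\|_1=1,\ \|u_{-S}\|_1\le L\},\qquad \phi_0^2(L,S):=\min\{s\,u^T\Sigma_0 u:\ \|u_S\|_1=1,\ \|u_{-S}\|_1\le L\}.$$ Empirical and theoretical restricted eigenvalues (nonnegative square roots of): $$\hat\kappa^2(L,S):=\min\{u^T\hat\Sigma u:\ \|u_S\|_2=1,\ \|u_{-S}\|_1\le L\|u_S\|_1\},\qquad \kappa_0^2(L,S):=\min\{u^T\Sigma_0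 u:\ \|u_S\|_2=1,\ \|u_{-S}\|_1\le L\|u_S\|_1\}.$$ *)

theory Defs
  imports "HOL-Probability.Probability"
begin

definition l1_norm :: "real ^ 'p::finite \<Rightarrow> real" where
  "l1_norm u = (\<Sum>j\<in>UNIV. \<bar>u $ j\<bar>)"

definition vec_restrict :: "real ^ 'p \<Rightarrow> 'p set \<Rightarrow> real ^ 'p::finite" where
  "vec_restrict u S = (\<chi> j. if j \<in> S then u $ j else 0)"

definition Lnorm :: "'w measure \<Rightarrow> real \<Rightarrow> ('w \<Rightarrow> real) \<Rightarrow> real" where
  "Lnorm M m Z = (\<integral>\<omega>. \<bar>Z \<omega>\<bar> powr m \<partial>M) powr (1 / m)"

definition weakly_isotropic ::
    "'w measure \<Rightarrow> ('w \<Rightarrow> real ^ 'p::finite) \<Rightarrow> real \<Rightarrow> real \<Rightarrow> bool" where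
  "weakly_isotropic M X0 m C \<longleftrightarrow>
     (\<forall>u. Lnorm M 2 (\<lambda>\<omega>. X0 \<omega> \<bullet> u) = 1 \<longrightarrow>
        (\<forall>t>0. \<P>(\<omega> in M. \<bar>X0 \<omega> \<bullet> u\<bar> > t) \<le> (C / t) powr m))"

text \<open>Integrability is stated explicitly because the Bochner integral of a non-integrable
  function is 0; it expresses that the moments on the left-hand side are finite.\<close>

definition bernstein :: "'w measure \<Rightarrow> ('w \<Rightarrow> real) \<Rightarrow> real \<Rightarrow> real \<Rightarrow> bool" where
  "bernstein M Z \<sigma> K \<longleftrightarrow>
     Z \<in> borel_measurable M \<and>
     (\<forall>k::nat. k \<ge> 2 \<longrightarrow>
        integrable M (\<lambda>\<omega>. \<bar>Z \<omega>\<bar> ^ k) \<and>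
        (\<integral>\<omega>. \<bar>Z \<omega>\<bar> ^ k \<partial>M) \<le> fact k / 2 * K ^ (k - 2) * \<sigma>\<^sup>2)"

definition Sigma0 :: "'w measure \<Rightarrow> ('w \<Rightarrow> real ^ 'p::finite) \<Rightarrow> real ^ 'p ^ 'p" where
  "Sigma0 M X0 = (\<chi> j k. \<integral>\<omega>. X0 \<omega> $ j * X0 \<omega> $ k \<partial>M)"

definition Sigma_hat :: "real ^ 'p ^ 'n \<Rightarrow> real ^ 'p ^ 'p::finite" where
  "Sigma_hat X = (1 / real CARD('n::finite)) *\<^sub>R (transpose X ** X)"

text \<open>The empirical and theoretical constants are the same functions of a matrix \<open>A\<close>, taken at
  the empirical and the theoretical second moment matrix.  The minima are written as infima;
  \<open>compat_sq_attained\<close> and \<open>re_sq_attained\<close> show that they are minima.\<close>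

definition compat_set :: "real \<Rightarrow> 'p set \<Rightarrow> (real ^ 'p::finite) set" where
  "compat_set L S =
     {u. l1_norm (vec_restrict u S) = 1 \<and> l1_norm (u - vec_restrict u S) \<le> L}"

definition compat_sq :: "real ^ 'p ^ 'p::finite \<Rightarrow> real \<Rightarrow> 'p set \<Rightarrow> real" where
  "compat_sq A L S = (INF u\<in>compat_set L S. real (card S) * (u \<bullet> (A *v u)))"

definition compat_const :: "real ^ 'p ^ 'p::finite \<Rightarrow> real \<Rightarrow> 'p set \<Rightarrow> real" where
  "compat_const A L S = sqrt (compat_sq A L S)"

definition re_set :: "real \<Rightarrow> 'p set \<Rightarrow> (real ^ 'p::finite) set" where
  "re_set L S =
     {u. norm (vec_restrict u S) = 1 \<and>
         l1_norm (u - vec_restrict u S) \<le> L * l1_norm (vec_restrict u S)}"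

definition re_sq :: "real ^ 'p ^ 'p::finite \<Rightarrow> real \<Rightarrow> 'p set \<Rightarrow> real" where
  "re_sq A L S = (INF u\<in>re_set L S. u \<bullet> (A *v u))"

definition restr_eig :: "real ^ 'p ^ 'p::finite \<Rightarrow> real \<Rightarrow> 'p set \<Rightarrow> real" where
  "restr_eig A L S = sqrt (re_sq A L S)"

lemma continuous_l1_norm [continuous_intros]:
  "continuous_on T f \<Longrightarrow> continuous_on T (\<lambda>u. l1_norm (f u :: real ^ 'p::finite))"
  unfolding l1_norm_def by (intro continuous_intros)

lemma continuous_vec_restrict [continuous_intros]:
  "continuous_on T (\<lambda>u::real ^ 'p::finite. vec_restrict u S)"
proof -
  have "continuous_on T (\<lambda>u::real ^ 'p. if j \<in> S then u $ j else 0)" for j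
    by (cases "j \<in> S") (auto intro!: continuous_intros)
  then show ?thesis
    unfolding vec_restrict_def by (intro continuous_on_vec_lambda)
qed

lemma norm_le_l1_norm: "norm u \<le> l1_norm u"
  unfolding l1_norm_def by (rule norm_le_l1_cart)

lemma l1_norm_le: "l1_norm (u :: real ^ 'p::finite) \<le> real CARD('p) * norm u"
proof -
  have "l1_norm u \<le> (\<Sum>j\<in>(UNIV :: 'p set). norm u)"
    unfolding l1_norm_def by (intro sum_mono component_le_norm_cart)
  then show ?thesis by simp
qed

lemma compact_compat_set: "compact (compat_set L S)"
proof -
  have "closed (compat_set L S)"
    unfolding compat_set_def
    by (intro closed_Collect_conj closed_Collect_eq closed_Collect_le continuous_intros)
  moreover have "norm u \<le> 1 + L" if "u \<in> compat_set L S" for u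
    using that norm_triangle_ineq[of "vec_restrict u S" "u - vec_restrict u S"]
      norm_le_l1_norm[of "vec_restrict u S"] norm_le_l1_norm[of "u - vec_restrict u S"]
    by (simp add: compat_set_def)
  ultimately show ?thesis
    unfolding compact_eq_bounded_closed bounded_iff by blast
qed

lemma compact_re_set:
  fixes S :: "'p::finite set"
  assumes "L \<ge> 0"
  shows "compact (re_set L S)"
proof -
  have "closed (re_set L S)"
    unfolding re_set_def
    by (intro closed_Collect_conj closed_Collect_eq closed_Collect_le continuous_intros)
  moreover have "norm u \<le> 1 + L * real CARD('p)" if "u \<in> re_set L S" for u
  proof -
    have "L * l1_norm (vec_restrict u S) \<le> L * real CARD('p)"
      using that l1_norm_le[of "vec_restrict u S"] assms
      by (intro mult_left_mono) (auto simp: re_set_def)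
    then show ?thesis
      using that norm_triangle_ineq[of "vec_restrict u S" "u - vec_restrict u S"]
        norm_le_l1_norm[of "u - vec_restrict u S"]
      by (simp add: re_set_def)
  qed
  ultimately show ?thesis
    unfolding compact_eq_bounded_closed bounded_iff by blast
qed

lemma axis_mem:
  assumes "j \<in> S" "L \<ge> 0"
  shows "axis j 1 \<in> compat_set L S" "axis j 1 \<in> re_set L S"
proof -
  have r: "vec_restrict (axis j 1) S = axis j (1::real)"
    using assms(1) by (auto simp: vec_restrict_def axis_def vec_eq_iff)
  have l: "l1_norm (axis j 1) = 1" "l1_norm (0 :: real ^ 'a) = 0"
    by (simp_all add: l1_norm_def axis_def if_distrib[of abs] cong: if_cong)
  show "axis j 1 \<in> compat_set L S" "axis j 1 \<in> re_set L S"
    using assms(2) by (simp_all add: compat_set_def re_set_def r l norm_axis_1)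
qed

lemma INF_attained_compact:
  fixes f :: "'x::topological_space \<Rightarrow> real"
  assumes "compact T" "T \<noteq> {}" "continuous_on T f"
  shows "\<exists>u\<in>T. (INF v\<in>T. f v) = f u \<and> (\<forall>v\<in>T. f u \<le> f v)"
proof -
  obtain u where u: "u \<in> T" "\<And>v. v \<in> T \<Longrightarrow> f u \<le> f v"
    using continuous_attains_inf[OF assms] by blast
  then have "(INF v\<in>T. f v) = f u"
    by (intro cInf_eq_minimum) auto
  with u show ?thesis by blast
qed

lemma compat_sq_attained:
  assumes "S \<noteq> {}" "L \<ge> 0"
  shows "\<exists>u\<in>compat_set L S. compat_sq A L S = real (card S) * (u \<bullet> (A *v u)) \<and>
           (\<forall>v\<in>compat_set L S. real (card S) * (u \<bullet> (A *v u)) \<le> real (card S) * (v \<bullet> (A *v v)))"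
  unfolding compat_sq_def
  using assms axis_mem(1)[of _ S L]
  by (intro INF_attained_compact compact_compat_set continuous_intros
        linear_continuous_on_compose[of _ _ "(*v) A"]) auto

lemma re_sq_attained:
  assumes "S \<noteq> {}" "L \<ge> 0"
  shows "\<exists>u\<in>re_set L S. re_sq A L S = u \<bullet> (A *v u) \<and>
           (\<forall>v\<in>re_set L S. u \<bullet> (A *v u) \<le> v \<bullet> (A *v v))"
  unfolding re_sq_def
  using assms axis_mem(2)[of _ S L]
  by (intro INF_attained_compact compact_re_set continuous_intros
        linear_continuous_on_compose[of _ _ "(*v) A"]) auto

definition D_const :: "real \<Rightarrow> real \<Rightarrow> real" where
  "D_const m C = (2 * C) powr (m / (m - 1)) * ((m - 1) / (m - 2))"

definition delta_n :: "nat \<Rightarrow> nat \<Rightarrow> real \<Rightarrow> real \<Rightarrow> real" where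
  "delta_n n p \<sigma> K =
     \<sigma> * sqrt (2 * ln (2 * real p) / real n) + K * (ln (2 * real p) / real n)"

definition Delta_L ::
    "nat \<Rightarrow> nat \<Rightarrow> real \<Rightarrow> real \<Rightarrow> real \<Rightarrow> real \<Rightarrow> real \<Rightarrow> real \<Rightarrow> real" where
  "Delta_L n p m C \<sigma> K M t =
     D_const m C * (16 * M * delta_n n p \<sigma> K + sqrt (2 * t / real n)) powr ((m - 2) / (m - 1))
     + 8 * (D_const m C)\<^sup>2 / 3 * (t / real n) powr ((m - 2) / (m - 1))"

end

theory Submission
  imports Defs
begin

text \<open>
  Truncate: with \<open>f\<^sub>u(x) = min ((x \<bullet> u)\<^sup>2) (K\<^sup>2)\<close>, the empirical quadratic form at \<open>u\<close> dominates the
  empirical mean of \<open>f\<^sub>u\<close>, and weak isotropy bounds the loss in expectation by a multiple of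
  \<open>K powr (2 - m)\<close>.  The supremum over \<open>u\<close> of the deviations \<open>E f\<^sub>u - P\<^sub>n f\<^sub>u\<close> has mean at most
  \<open>4 K M \<delta>\<^sub>n\<close> by symmetrisation, contraction and a maximal inequality for Bernstein variables.
  Because \<open>f\<^sub>u \<ge> 0\<close>, its upper tail is governed by the weak variance \<open>sup E f\<^sub>u\<^sup>2 \<le> K\<^sup>2\<close>, and this
  follows from a plain martingale argument, coordinate by coordinate, with leading constant one.
  Optimising over \<open>K\<close> leaves a factor two to spare in \<open>D\<^sub>m\<close>; since \<open>M \<sigma>\<^sub>X \<ge> 1\<close> this pays for
  replacing \<open>t\<close> by \<open>t + ln 2\<close>, so that both inequalities hold on one event by a union bound.
\<close>

section \<open>Exponential moments of maxima of sums\<close>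

text \<open>The weak variance is of order \<open>K\<^sup>2\<close>, not the square of that, because
  \<open>f\<^sub>u\<close> lies both below \<open>K\<^sup>2\<close> and below
  \<open>(x \<bullet> u)\<^sup>2\<close>, whose mean is normalised to 1. The exponential bound needs
  the scaled functions to stay below 1, which limits the Laplace parameter. This limit costs
  nothing: for \<open>\<Delta> \<ge> 1\<close> the claim is trivial, as empirical forms are
  nonnegative, and \<open>\<Delta> < 1\<close> forces \<open>K * \<epsilon> \<le> 1 / 2\<close>. No
  estimate depends on the number of directions \<open>u\<close>: contraction leaves a process linear
  in \<open>u\<close>, which the duality of the l1 and sup norms reduces to the coordinates. Hence
  finite sets of directions suffice, and continuity extends the bound to all of them. Both ratios
  then follow from one uniform statement about directions of bounded l1 norm and unit theoretical
  form: rescaling a minimiser of the empirical problem to unit theoretical form puts it in this set,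
  and its l1 norm is what the argument \<open>M\<close> of \<open>Delta_L\<close> bounds.\<close>

lemma MAX_le_MAX_add:
  fixes f g :: "'t \<Rightarrow> real"
  assumes "finite T" "T \<noteq> {}" "\<And>t. t \<in> T \<Longrightarrow> f t \<le> g t + d"
  shows "(MAX t\<in>T. f t) \<le> (MAX t\<in>T. g t) + d"
proof -
  have "f t \<le> (MAX t\<in>T. g t) + d" if "t \<in> T" for t
    using assms(3)[OF that] Max_ge[OF finite_imageI[OF assms(1)] imageI[OF that], of g] by linarith
  then show ?thesis
    using assms by (simp add: Max_le_iff)
qed

lemma MAX_attained:
  fixes f :: "'t \<Rightarrow> real"
  assumes "finite T" "T \<noteq> {}"
  obtains t where "t \<in> T" "(MAX t\<in>T. f t) = f t"
proof -
  have "(MAX t\<in>T. f t) \<in> f ` T" using assms by (intro Max_in) auto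
  then show thesis using that by blast
qed

lemma abs_MAX_le:
  fixes f :: "'t \<Rightarrow> real"
  assumes "finite T" "T \<noteq> {}" "\<And>t. t \<in> T \<Longrightarrow> \<bar>f t\<bar> \<le> B"
  shows "\<bar>MAX t\<in>T. f t\<bar> \<le> B"
  using assms MAX_attained[of T f] by metis

lemma integrable_MAX:
  fixes f :: "'t \<Rightarrow> 'a \<Rightarrow> real"
  assumes "finite T" "T \<noteq> {}" "\<And>t. t \<in> T \<Longrightarrow> integrable M (f t)"
  shows "integrable M (\<lambda>x. MAX t\<in>T. f t x)"
  using assms
proof (induct T rule: finite_ne_induct)
  case (insert t T)
  then show ?case by (simp add: integrable_max)
qed simp

lemma exp_le_quadratic:
  fixes v :: real
  assumes "\<bar>v\<bar> \<le> 1"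
  shows "exp v \<le> 1 + v + v\<^sup>2"
proof (cases "v \<ge> 0")
  case True
  then show ?thesis using exp_bound assms by simp
next
  case False
  define g where "g = (\<lambda>v::real. 1 + v + v\<^sup>2 - exp v)"
  have "\<exists>y. (g has_real_derivative y) (at x) \<and> y \<le> 0" if "v \<le> x" "x \<le> 0" for x
  proof (intro exI conjI)
    show "(g has_real_derivative 1 + 2 * x - exp x) (at x)"
      unfolding g_def by (auto intro!: derivative_eq_intros)
    have "- x \<ge> 0" "- x \<le> 1" using that assms by auto
    \<comment> \<open>This is \<open>1 + 2 * x - exp x \<le> 0\<close> multiplied by
      \<open>exp (- x)\<close>, which brings in the known bound at the nonnegative argument
      \<open>- x\<close>.\<close>
    have "exp (- x) * (1 + 2 * x) \<le> 1"
    proof (cases "1 + 2 * x \<le> 0")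
      case True
      then show ?thesis
        by (smt (verit) exp_gt_zero mult_nonneg_nonpos)
    next
      case F: False
      have "exp (- x) \<le> 1 + (-x) + (-x)\<^sup>2"
        using exp_bound[of "-x"] \<open>- x \<ge> 0\<close> \<open>- x \<le> 1\<close> by simp
      then have "exp (- x) * (1 + 2 * x) \<le> (1 + (-x) + (-x)\<^sup>2) * (1 + 2 * x)"
        using F by (intro mult_right_mono) auto
      also have "\<dots> = 1 + x - x\<^sup>2 + 2 * (x * x\<^sup>2)"
        by (simp add: algebra_simps power2_eq_square)
      also have "\<dots> \<le> 1"
        using mult_nonpos_nonneg[OF that(2) zero_le_power2[of x]] that(2) zero_le_power2[of x] by linarith
      finally show ?thesis .
    qed
    then show "1 + 2 * x - exp x \<le> 0"
      by (simp add: exp_minus field_simps)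
  qed
  then have "g v \<ge> g 0"
    using DERIV_nonpos_imp_nonincreasing[of v 0 g] False by force
  then show ?thesis by (simp add: g_def)
qed

text \<open>The squared positive parts of \<open>H x - H y\<close> and \<open>H y - H x\<close> add
  up to \<open>(H x - H y)\<^sup>2\<close>, whose double integral is twice the variance. By symmetry
  the variance equals the double integral of one of them, so a one-sided bound for each fixed
  \<open>x\<close> gives variance at most \<open>c\<close>. The oscillation bound puts
  \<open>H - \<mu>\<close> in [-1, 1], where \<open>exp_le_quadratic\<close> applies and the linear
  term integrates to 0.\<close>

lemma (in prob_space) exp_moment_le_variance:
  assumes H[measurable]: "H \<in> borel_measurable M"
    and osc: "\<And>x y. x \<in> space M \<Longrightarrow> y \<in> space M \<Longrightarrow> H x - H y \<le> (1::real)"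
    and var: "\<And>x. x \<in> space M \<Longrightarrow> (\<integral>y. (max 0 (H x - H y))\<^sup>2 \<partial>M) \<le> c"
  shows "(\<integral>x. exp (H x) \<partial>M) \<le> exp (c + (\<integral>x. H x \<partial>M))"
proof -
  interpret P: pair_prob_space M M ..
  have one[simp]: "measure M (space M) = 1" by (rule prob_space)
  obtain x0 where x0: "x0 \<in> space M" using not_empty by blast
  define B where "B = \<bar>H x0\<bar> + 1"
  have HB: "\<bar>H x\<bar> \<le> B" if "x \<in> space M" for x
    using osc[OF x0 that] osc[OF that x0] by (auto simp: B_def)
  have intH: "integrable M H"
    using HB by (intro integrable_const_bound[where B=B]) auto
  define \<mu> where "\<mu> = (\<integral>x. H x \<partial>M)"
  have osc': "\<bar>H x - \<mu>\<bar> \<le> 1" if "x \<in> space M" for x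
  proof -
    have "(\<integral>y. H x - H y \<partial>M) \<le> (\<integral>y. 1 \<partial>M)"
      by (rule integral_mono) (use intH osc that in auto)
    moreover have "(\<integral>y. H y - H x \<partial>M) \<le> (\<integral>y. 1 \<partial>M)"
      by (rule integral_mono) (use intH osc that in auto)
    ultimately
    show ?thesis using intH by (simp add: \<mu>_def)
  qed
  have intsq: "integrable M (\<lambda>x. (H x - \<mu>)\<^sup>2)"
    using osc' by (intro integrable_const_bound[where B=1]) (auto simp: abs_square_le_1)
  define p where "p x y = (max 0 (H x - H y))\<^sup>2" for x y
  have p1: "0 \<le> p x y" "p x y \<le> 1" if "x \<in> space M" "y \<in> space M" for x y
    using osc[OF that] by (auto simp: p_def abs_square_le_1)
  have [measurable]: "case_prod p \<in> borel_measurable (M \<Otimes>\<^sub>M M)"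
    unfolding p_def by measurable
  have intp: "integrable (M \<Otimes>\<^sub>M M) (case_prod p)"
    using p1 by (intro P.integrable_const_bound[where B=1]) (auto simp: space_pair_measure)
  have [measurable]: "(\<lambda>y. p x y) \<in> borel_measurable M" "(\<lambda>y. p y x) \<in> borel_measurable M" for x
    unfolding p_def by measurable
  have intpx: "integrable M (\<lambda>y. p x y)" "integrable M (\<lambda>y. p y x)" if "x \<in> space M" for x
    using p1 that by (auto intro!: integrable_const_bound[where B=1])
  have pc: "(\<integral>y. p x y \<partial>M) \<le> c" if "x \<in> space M" for x
    using var[OF that] by (simp add: p_def)
  have "(\<integral>y. p x y \<partial>M) + (\<integral>y. p y x \<partial>M) = (H x - \<mu>)\<^sup>2 + (\<integral>y. (H y - \<mu>)\<^sup>2 \<partial>M)"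
    if "x \<in> space M" for x
  proof -
    have "(\<integral>y. p x y \<partial>M) + (\<integral>y. p y x \<partial>M) = (\<integral>y. p x y + p y x \<partial>M)"
      using intpx[OF that] by simp
    also have "\<dots> = (\<integral>y. ((H x - \<mu>)\<^sup>2 - 2 * (H x - \<mu>) * (H y - \<mu>)) + (H y - \<mu>)\<^sup>2 \<partial>M)"
      by (intro Bochner_Integration.integral_cong)
         (auto simp: p_def max_def power2_eq_square algebra_simps)
    also have "\<dots> = (H x - \<mu>)\<^sup>2 + (\<integral>y. (H y - \<mu>)\<^sup>2 \<partial>M)"
      using intH intsq by (simp add: prob_space \<mu>_def)
    finally show ?thesis .
  qed
  then have "(\<integral>x. (\<integral>y. p x y \<partial>M) + (\<integral>y. p y x \<partial>M) \<partial>M)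
      = (\<integral>x. (H x - \<mu>)\<^sup>2 + (\<integral>y. (H y - \<mu>)\<^sup>2 \<partial>M) \<partial>M)"
    by (intro Bochner_Integration.integral_cong) auto
  also have "\<dots> = 2 * (\<integral>y. (H y - \<mu>)\<^sup>2 \<partial>M)"
    using intsq by (simp add: prob_space)
  finally have "2 * (\<integral>y. (H y - \<mu>)\<^sup>2 \<partial>M) = (\<integral>x. (\<integral>y. p x y \<partial>M) \<partial>M) + (\<integral>x. (\<integral>y. p y x \<partial>M) \<partial>M)"
    using P.integrable_fst[OF intp] P.integrable_snd[OF intp] by simp
  also have "\<dots> = 2 * (\<integral>x. (\<integral>y. p x y \<partial>M) \<partial>M)"
    using P.Fubini_integral[OF intp] by simp
  also have "(\<integral>x. (\<integral>y. p x y \<partial>M) \<partial>M) \<le> (\<integral>x. c \<partial>M)"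
    using P.integrable_fst[OF intp] pc by (intro integral_mono) auto
  finally have V: "(\<integral>y. (H y - \<mu>)\<^sup>2 \<partial>M) \<le> c" by (simp add: prob_space)
  have "(\<integral>x. exp (H x - \<mu>) \<partial>M) \<le> (\<integral>x. 1 + (H x - \<mu>) + (H x - \<mu>)\<^sup>2 \<partial>M)"
  proof (rule integral_mono)
    show "integrable M (\<lambda>x. exp (H x - \<mu>))"
      using osc' by (intro integrable_const_bound[where B="exp 1"]) (auto simp: abs_le_iff)
  qed (use intH intsq osc' in \<open>auto intro!: exp_le_quadratic\<close>)
  also have "\<dots> = 1 + (\<integral>y. (H y - \<mu>)\<^sup>2 \<partial>M)"
    using intH intsq by (simp add: prob_space \<mu>_def)
  also have "\<dots> \<le> exp c"
    using V exp_ge_add_one_self[of c] by linarith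
  finally have "(\<integral>x. exp (H x - \<mu>) \<partial>M) \<le> exp c" .
  then have "(\<integral>x. exp (H x) \<partial>M) / exp \<mu> \<le> exp c"
    by (simp add: exp_diff)
  then show ?thesis
    by (simp add: exp_add \<mu>_def field_simps)
qed

text \<open>Replacing a coordinate \<open>x\<close> by an independent \<open>z\<close> can lower the maximum by at most \<open>f t z\<close>,
  where \<open>t\<close> maximises at \<open>x\<close> and hence does not depend on \<open>z\<close>.  This uses \<open>f \<ge> 0\<close> and brings in
  the weak variance \<open>sup E f\<^sup>2\<close> rather than the mean of the supremum of the squares.\<close>

lemma (in pair_prob_space) exp_integral_MAX_le:
  fixes f :: "'t \<Rightarrow> 'a \<Rightarrow> real" and a :: "'t \<Rightarrow> 'b \<Rightarrow> real"
  assumes T: "finite T" "T \<noteq> {}"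
    and a[measurable]: "\<And>t. t \<in> T \<Longrightarrow> a t \<in> borel_measurable M2"
    and aB: "\<And>t y. t \<in> T \<Longrightarrow> y \<in> space M2 \<Longrightarrow> \<bar>a t y\<bar> \<le> B"
    and f[measurable]: "\<And>t. t \<in> T \<Longrightarrow> f t \<in> borel_measurable M1"
    and f01: "\<And>t x. t \<in> T \<Longrightarrow> x \<in> space M1 \<Longrightarrow> 0 \<le> f t x \<and> f t x \<le> 1"
    and fc: "\<And>t. t \<in> T \<Longrightarrow> (\<integral>x. (f t x)\<^sup>2 \<partial>M1) \<le> c"
  shows "(\<integral>x. exp (\<integral>y. (MAX t\<in>T. a t y - f t x) \<partial>M2) \<partial>M1)
    \<le> exp (c + (\<integral>x. (\<integral>y. (MAX t\<in>T. a t y - f t x) \<partial>M2) \<partial>M1))"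
proof -
  define m where "m x y = (MAX t\<in>T. a t y - f t x)" for x y
  define H where "H x = (\<integral>y. m x y \<partial>M2)" for x
  have [measurable]: "case_prod m \<in> borel_measurable (M1 \<Otimes>\<^sub>M M2)"
    unfolding m_def case_prod_beta by (intro borel_measurable_Max T) measurable
  have [measurable]: "H \<in> borel_measurable M1" unfolding H_def by measurable
  have mB: "\<bar>m x y\<bar> \<le> B + 1" if "x \<in> space M1" "y \<in> space M2" for x y
    unfolding m_def using aB[OF _ that(2)] f01[OF _ that(1)] by (intro abs_MAX_le T) (smt (verit))
  have mm: "m x y \<le> m x' y + 1" if "x \<in> space M1" "x' \<in> space M1" for x x' y
    unfolding m_def using f01[OF _ that(1)] f01[OF _ that(2)] by (intro MAX_le_MAX_add T) (smt (verit))
  have mint: "integrable M2 (\<lambda>y. m x y)" if "x \<in> space M1" for x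
    using mB[OF that] that by (intro M2.integrable_const_bound[where B="B+1"]) auto
  have Hosc: "H x - H x' \<le> 1" if "x \<in> space M1" "x' \<in> space M1" for x x'
  proof -
    have "H x \<le> (\<integral>y. m x' y + 1 \<partial>M2)"
      unfolding H_def using mint that mm by (intro integral_mono) auto
    then show ?thesis using mint[OF that(2)] by (simp add: H_def M2.prob_space)
  qed
  have "(\<integral>z. (max 0 (H x - H z))\<^sup>2 \<partial>M1) \<le> c" if x: "x \<in> space M1" for x
  proof -
    define w where "w z = max 0 (H x - H z)" for z
    have [measurable]: "w \<in> borel_measurable M1" unfolding w_def by measurable
    have w1: "0 \<le> w z" "w z \<le> 1" if "z \<in> space M1" for z
      using Hosc[OF x that] by (auto simp: w_def)
    have wint: "integrable M1 (\<lambda>z. (w z)\<^sup>2)"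
      using w1 by (intro M1.integrable_const_bound[where B=1]) (auto simp: abs_square_le_1)
    have fint: "integrable M1 (\<lambda>z. (f t z)\<^sup>2)" if "t \<in> T" for t
      using f01[OF that] that by (intro M1.integrable_const_bound[where B=1]) (auto simp: abs_square_le_1)
    \<comment> \<open>Self-bounding: integrating \<open>g z y\<close> over \<open>y\<close> gives
      \<open>(w z)\<^sup>2\<close>. Exchanging the integrals fixes \<open>y\<close> first, so that
      the maximiser \<open>t\<close> depends on \<open>x\<close> and \<open>y\<close> only. Then
      \<open>g z y \<le> w z * f t z\<close>, and splitting this product into half the sum of
      squares bounds the integral of \<open>w\<^sup>2\<close> by half of itself plus
      \<open>c / 2\<close>.\<close>
    define g where "g z y = w z * (m x y - m z y)" for z y
    have [measurable]: "case_prod g \<in> borel_measurable (M1 \<Otimes>\<^sub>M M2)"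
      unfolding g_def using x by measurable
    have gB: "\<bar>g z y\<bar> \<le> 1" if "z \<in> space M1" "y \<in> space M2" for z y
      unfolding g_def abs_mult using w1[OF that(1)] mm[OF x that(1), of y] mm[OF that(1) x, of y]
      by (intro mult_le_one) auto
    have gint: "integrable (M1 \<Otimes>\<^sub>M M2) (case_prod g)"
      using gB by (intro integrable_const_bound[where B=1]) (auto simp: space_pair_measure)
    have g1: "(\<integral>z. g z y \<partial>M1) \<le> (\<integral>z. (w z)\<^sup>2 \<partial>M1) / 2 + c / 2" if y: "y \<in> space M2" for y
    proof -
      obtain t where t: "t \<in> T" "m x y = a t y - f t x"
        by (rule MAX_attained[OF T, of "\<lambda>t. a t y - f t x"]) (simp add: m_def)
      have "g z y \<le> ((w z)\<^sup>2 + (f t z)\<^sup>2) / 2" if z: "z \<in> space M1" for z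
      proof -
        have "m z y \<ge> a t y - f t z"
          unfolding m_def using t T by (intro Max_ge) auto
        then have "m x y - m z y \<le> f t z"
          using t f01[OF t(1) x] by simp
        then have "g z y \<le> w z * f t z"
          unfolding g_def using w1[OF z] by (intro mult_left_mono) auto
        also have "\<dots> \<le> ((w z)\<^sup>2 + (f t z)\<^sup>2) / 2"
          using sum_squares_bound[of "w z" "f t z"] by simp
        finally show ?thesis .
      qed
      moreover have "(\<lambda>z. g z y) \<in> borel_measurable M1"
        using measurable_compose[OF measurable_Pair2'[OF y], of "case_prod g"] by simp
      then have "integrable M1 (\<lambda>z. g z y)"
        using gB[OF _ y] by (intro M1.integrable_const_bound[where B=1]) auto
      ultimately have "(\<integral>z. g z y \<partial>M1) \<le> (\<integral>z. ((w z)\<^sup>2 + (f t z)\<^sup>2) / 2 \<partial>M1)"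
        using wint fint[OF t(1)] by (intro integral_mono) auto
      also have "\<dots> = (\<integral>z. (w z)\<^sup>2 \<partial>M1) / 2 + (\<integral>z. (f t z)\<^sup>2 \<partial>M1) / 2"
        using wint fint[OF t(1)] by simp
      finally show ?thesis using fc[OF t(1)] by simp
    qed
    have "(\<integral>z. (w z)\<^sup>2 \<partial>M1) = (\<integral>z. (\<integral>y. g z y \<partial>M2) \<partial>M1)"
    proof (intro Bochner_Integration.integral_cong refl)
      fix z assume z: "z \<in> space M1"
      have "(\<integral>y. g z y \<partial>M2) = w z * (H x - H z)"
        unfolding g_def H_def using mint[OF x] mint[OF z] by simp
      then show "(w z)\<^sup>2 = (\<integral>y. g z y \<partial>M2)"
        by (simp add: w_def max_def power2_eq_square)
    qed
    also have "\<dots> = (\<integral>y. (\<integral>z. g z y \<partial>M1) \<partial>M2)"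
      using Fubini_integral[OF gint] by simp
    also have "\<dots> \<le> (\<integral>y. (\<integral>z. (w z)\<^sup>2 \<partial>M1) / 2 + c / 2 \<partial>M2)"
      using integrable_snd[OF gint] g1 by (intro integral_mono) auto
    finally show ?thesis by (simp add: M2.prob_space w_def)
  qed
  with Hosc have "(\<integral>x. exp (H x) \<partial>M1) \<le> exp (c + (\<integral>x. H x \<partial>M1))"
    by (intro M1.exp_moment_le_variance) auto
  then show ?thesis by (simp add: H_def m_def)
qed

lemma sum_insert_fun_upd:
  assumes "finite I" "i \<notin> I"
  shows "(\<Sum>j\<in>insert i I. g ((X(i := x)) j)) = g x + (\<Sum>j\<in>I. g (X j))"
proof -
  have "(\<Sum>j\<in>I. g ((X(i := x)) j)) = (\<Sum>j\<in>I. g (X j))"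
    using assms(2) by (intro sum.cong) auto
  then show ?thesis using assms by simp
qed

section \<open>Splitting off one coordinate of a product measure, and exponential moments of
  maxima\<close>

context prob_space
begin

lemma prob_space_PiM_const: "prob_space (PiM I (\<lambda>_. M))"
  by (intro prob_space_PiM prob_space_axioms)

lemma pair_prob_space_PiM_const: "pair_prob_space M (PiM I (\<lambda>_. M))"
proof -
  interpret Q: prob_space "PiM I (\<lambda>_. M)" by (rule prob_space_PiM_const)
  show ?thesis ..
qed

lemma measurable_insert_PiM[measurable]:
  "(\<lambda>(x, X). X(i := x)) \<in> measurable (M \<Otimes>\<^sub>M PiM I (\<lambda>_. M)) (PiM (insert i I) (\<lambda>_. M))"
  by measurable

lemma integrable_PiM_insert:
  fixes F :: "('i \<Rightarrow> 'a) \<Rightarrow> real"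
  assumes "integrable (PiM (insert i I) (\<lambda>_. M)) F"
  shows "integrable (M \<Otimes>\<^sub>M PiM I (\<lambda>_. M)) (\<lambda>(x, X). F (X(i := x)))"
proof -
  have "integrable (distr (M \<Otimes>\<^sub>M PiM I (\<lambda>_. M)) (PiM (insert i I) (\<lambda>_. M)) (\<lambda>(x, X). X(i := x))) F"
    using assms by (subst distr_pair_PiM_eq_PiM) (auto simp: prob_space_axioms)
  from integrable_distr[OF measurable_insert_PiM this] show ?thesis
    by (simp add: case_prod_beta')
qed

lemma integral_PiM_insert:
  fixes F :: "('i \<Rightarrow> 'a) \<Rightarrow> real"
  assumes F: "F \<in> borel_measurable (PiM (insert i I) (\<lambda>_. M))"
  shows "(\<integral>X. F X \<partial>PiM (insert i I) (\<lambda>_. M)) = (\<integral>(x, X). F (X(i := x)) \<partial>(M \<Otimes>\<^sub>M PiM I (\<lambda>_. M)))"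
proof -
  have "(\<integral>X. F X \<partial>PiM (insert i I) (\<lambda>_. M)) =
    (\<integral>X. F X \<partial>distr (M \<Otimes>\<^sub>M PiM I (\<lambda>_. M)) (PiM (insert i I) (\<lambda>_. M)) (\<lambda>(x, X). X(i := x)))"
    by (subst distr_pair_PiM_eq_PiM) (auto simp: prob_space_axioms)
  also have "\<dots> = (\<integral>(x, X). F (X(i := x)) \<partial>(M \<Otimes>\<^sub>M PiM I (\<lambda>_. M)))"
    by (subst integral_distr[OF measurable_insert_PiM F]) (simp add: case_prod_beta')
  finally show ?thesis .
qed

text \<open>Induction that exposes one coordinate at a time. For a fixed new coordinate
  \<open>x\<close>, the induction hypothesis with offset \<open>a t - f t x\<close> bounds the inner
  integral by \<open>exp (H x)\<close> times \<open>exp c\<close> for each old coordinate, where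
  \<open>H x\<close> is the conditional mean of the maximum. The fluctuation of \<open>H\<close>
  around its own mean costs one more factor \<open>exp c\<close>, by
  \<open>exp_integral_MAX_le\<close>. The arbitrary offset \<open>a\<close> is what makes the
  induction close.\<close>

lemma exp_MAX_sum_le:
  fixes f :: "'t \<Rightarrow> 'a \<Rightarrow> real" and a :: "'t \<Rightarrow> real"
  assumes T: "finite T" "T \<noteq> {}" and I: "finite I"
    and f[measurable]: "\<And>t. t \<in> T \<Longrightarrow> f t \<in> borel_measurable M"
    and f01: "\<And>t x. t \<in> T \<Longrightarrow> x \<in> space M \<Longrightarrow> 0 \<le> f t x \<and> f t x \<le> 1"
    and fc: "\<And>t. t \<in> T \<Longrightarrow> (\<integral>x. (f t x)\<^sup>2 \<partial>M) \<le> c"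
  shows "(\<integral>X. exp (MAX t\<in>T. a t - (\<Sum>i\<in>I. f t (X i))) \<partial>PiM I (\<lambda>_. M))
    \<le> exp (real (card I) * c + (\<integral>X. (MAX t\<in>T. a t - (\<Sum>i\<in>I. f t (X i))) \<partial>PiM I (\<lambda>_. M)))"
  using I
proof (induct I arbitrary: a)
  case empty
  interpret Q: prob_space "PiM {} (\<lambda>_. M)" by (rule prob_space_PiM_const)
  show ?case by (simp add: Q.prob_space)
next
  case (insert i I)
  let ?Q = "PiM I (\<lambda>_. M)" and ?R = "PiM (insert i I) (\<lambda>_. M)"
  interpret P: pair_prob_space M ?Q by (rule pair_prob_space_PiM_const)
  interpret R: prob_space ?R by (rule prob_space_PiM_const)
  define Z where "Z X = (MAX t\<in>T. a t - (\<Sum>j\<in>insert i I. f t (X j)))" for X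
  define b where "b t X = a t - (\<Sum>j\<in>I. f t (X j))" for t X
  have Zeq: "Z (X(i := x)) = (MAX t\<in>T. b t X - f t x)" for X x
    unfolding Z_def b_def sum_insert_fun_upd[OF insert(1,2)] by (simp add: algebra_simps)
  have [measurable]: "Z \<in> borel_measurable ?R"
    unfolding Z_def using T insert(1) by measurable
  have sumB: "0 \<le> (\<Sum>j\<in>J. f t (X j)) \<and> (\<Sum>j\<in>J. f t (X j)) \<le> real (card J)"
    if "t \<in> T" "X \<in> space (PiM J (\<lambda>_. M))" for t X and J :: "'b set"
  proof -
    have "0 \<le> f t (X j) \<and> f t (X j) \<le> 1" if "j \<in> J" for j
      using f01[OF \<open>t \<in> T\<close>, of "X j"] \<open>X \<in> _\<close> that by (auto simp: space_PiM)
    then show ?thesis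
      using sum_mono[of J "\<lambda>j. f t (X j)" "\<lambda>_. 1"] by (auto intro!: sum_nonneg)
  qed
  define A where "A = (\<Sum>t\<in>T. \<bar>a t\<bar>)"
  have A0: "A \<ge> 0" by (simp add: A_def sum_nonneg)
  have aA: "\<bar>a t\<bar> \<le> A" if "t \<in> T" for t
    unfolding A_def using that T by (intro member_le_sum) auto
  have ZB: "\<bar>Z X\<bar> \<le> A + card (insert i I)" if "X \<in> space ?R" for X
    unfolding Z_def using sumB[OF _ that] aA by (intro abs_MAX_le T) (smt (verit))
  have Zint: "integrable ?R Z"
    using ZB by (intro R.integrable_const_bound[where B="A + card (insert i I)"]) auto
  have eZint: "integrable ?R (\<lambda>X. exp (Z X))"
    using ZB by (intro R.integrable_const_bound[where B="exp (A + card (insert i I))"]) (auto simp: abs_le_iff)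
  have [measurable]: "b t \<in> borel_measurable ?Q" if "t \<in> T" for t
    unfolding b_def using that insert(1) by measurable
  have bB: "\<bar>b t X\<bar> \<le> A + card I" if "t \<in> T" "X \<in> space ?Q" for t X
    unfolding b_def using sumB[OF that] aA[OF that(1)] by linarith
  define H where "H x = (\<integral>X. (MAX t\<in>T. b t X - f t x) \<partial>?Q)" for x
  have "(\<integral>X. exp (Z X) \<partial>?R) = (\<integral>(x, X). exp (Z (X(i := x))) \<partial>(M \<Otimes>\<^sub>M ?Q))"
    by (subst integral_PiM_insert) auto
  also have "\<dots> = (\<integral>x. (\<integral>X. exp (Z (X(i := x))) \<partial>?Q) \<partial>M)"
    using P.integral_fst'[OF integrable_PiM_insert[OF eZint]] by simp
  also have "\<dots> \<le> (\<integral>x. exp (real (card I) * c) * exp (H x) \<partial>M)"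
  proof (rule integral_mono)
    show "integrable M (\<lambda>x. \<integral>X. exp (Z (X(i := x))) \<partial>?Q)"
      using P.integrable_fst'[OF integrable_PiM_insert[OF eZint]] by simp
    have [measurable]: "H \<in> borel_measurable M"
      unfolding H_def by (intro P.M2.borel_measurable_lebesgue_integral)
        (unfold case_prod_beta, intro borel_measurable_Max T, measurable)
    have "\<bar>H x\<bar> \<le> A + card I + 1" if "x \<in> space M" for x
    proof -
      have "\<bar>H x\<bar> \<le> (\<integral>X. \<bar>MAX t\<in>T. b t X - f t x\<bar> \<partial>?Q)"
        unfolding H_def by (rule integral_abs_bound)
      also have "\<dots> \<le> (\<integral>X. A + card I + 1 \<partial>?Q)"
        by (rule integral_mono_AE')
           (use bB A0 f01[OF _ that] in \<open>auto intro!: AE_I2 abs_MAX_le T, smt (verit)\<close>)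
      finally show ?thesis by (simp add: P.M2.prob_space)
    qed
    then show "integrable M (\<lambda>x. exp (real (card I) * c) * exp (H x))"
      by (intro integrable_mult_right integrable_const_bound[where B="exp (A + card I + 1)"])
         (auto simp: abs_le_iff)
    fix x assume "x \<in> space M"
    have "Z (X(i := x)) = (MAX t\<in>T. (a t - f t x) - (\<Sum>j\<in>I. f t (X j)))" for X
      unfolding Zeq b_def by (simp add: algebra_simps)
    then show "(\<integral>X. exp (Z (X(i := x))) \<partial>?Q) \<le> exp (real (card I) * c) * exp (H x)"
      using insert(3)[of "\<lambda>t. a t - f t x"]
      by (simp add: H_def Zeq[symmetric] exp_add[symmetric])
  qed
  also have "\<dots> = exp (real (card I) * c) * (\<integral>x. exp (H x) \<partial>M)"
    by simp
  also have "\<dots> \<le> exp (real (card I) * c) * exp (c + (\<integral>x. H x \<partial>M))"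
    unfolding H_def using bB f01 fc T
    by (intro mult_left_mono P.exp_integral_MAX_le[where B="A + card I"]) auto
  also have "(\<integral>x. H x \<partial>M) = (\<integral>(x, X). Z (X(i := x)) \<partial>(M \<Otimes>\<^sub>M ?Q))"
    using P.integral_fst'[OF integrable_PiM_insert[OF Zint]] by (simp add: H_def Zeq)
  also have "\<dots> = (\<integral>X. Z X \<partial>?R)"
    by (subst integral_PiM_insert) auto
  finally show ?case
    using insert(1,2) by (simp add: Z_def exp_add[symmetric] algebra_simps)
qed

end

section \<open>Symmetrisation and contraction\<close>

text \<open>Each observation carries its own Rademacher sign. The signed sample is therefore again a
  product measure over the same index set, and an induction can exchange \<open>M\<close> for
  \<open>signed\<close> in one factor at a time.\<close>

definition (in prob_space) signed :: "('a \<times> real) measure" where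
  "signed = M \<Otimes>\<^sub>M measure_pmf (pmf_of_set {-1, 1})"

section \<open>Integrability on pairs, and integration against a random sign\<close>

context pair_prob_space
begin

lemma integrable_pair_fst:
  fixes f :: "'a \<Rightarrow> real"
  assumes "integrable M1 f"
  shows "integrable (M1 \<Otimes>\<^sub>M M2) (\<lambda>p. f (fst p))"
proof (rule integrable_distr[OF measurable_fst])
  show "integrable (distr (M1 \<Otimes>\<^sub>M M2) M1 fst) f"
    using assms by (simp add: M2.distr_pair_fst)
qed

lemma integrable_pair_snd:
  fixes f :: "'b \<Rightarrow> real"
  assumes "integrable M2 f"
  shows "integrable (M1 \<Otimes>\<^sub>M M2) (\<lambda>p. f (snd p))"
proof -
  interpret Q: pair_prob_space M2 M1 ..
  show ?thesis
    using Q.integrable_product_swap[OF Q.integrable_pair_fst[OF assms]] by (simp add: case_prod_beta')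
qed

end

context prob_space
begin

lemma prob_space_signed: "prob_space signed"
proof -
  interpret P: pair_prob_space M "measure_pmf (pmf_of_set {-1, 1::real})" ..
  show ?thesis unfolding signed_def by (rule P.prob_space_axioms)
qed

lemma measurable_signed:
  assumes [measurable]: "h \<in> borel_measurable M"
  shows "(\<lambda>(x, e). e * h x) \<in> borel_measurable signed"
proof -
  have [measurable]: "(\<lambda>e. e) \<in> borel_measurable (measure_pmf (pmf_of_set {-1, 1::real}))" by simp
  show ?thesis unfolding signed_def by measurable
qed

lemma AE_signed: "AE p in signed. snd p \<in> {-1, 1}"
proof -
  interpret P: pair_prob_space M "measure_pmf (pmf_of_set {-1, 1::real})" ..
  show ?thesis
    unfolding signed_def
    by (rule P.AE_pair_measure) (auto simp: space_pair_measure AE_measure_pmf_iff)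
qed

text \<open>The sign is a real number that is almost surely 1 or -1, so domination at these two
  values is enough.\<close>

lemma integrable_signed_bound:
  fixes F :: "'a \<times> real \<Rightarrow> real"
  assumes F: "F \<in> borel_measurable signed" and g: "integrable M g"
    and le: "\<And>x. \<bar>F (x, 1)\<bar> \<le> g x" "\<And>x. \<bar>F (x, -1)\<bar> \<le> g x"
  shows "integrable signed F"
proof -
  interpret P: pair_prob_space M "measure_pmf (pmf_of_set {-1, 1::real})" ..
  have "AE p in signed. norm (F p) \<le> norm (g (fst p))"
    using AE_signed
  proof eventually_elim
    case (elim p)
    then show ?case using le[of "fst p"] by (cases p) auto
  qed
  moreover have "integrable signed (\<lambda>p. g (fst p))"
    unfolding signed_def by (rule P.integrable_pair_fst[OF g])
  ultimately show ?thesis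
    using Bochner_Integration.integrable_bound[OF _ F] by blast
qed

lemma integrable_signed:
  fixes h :: "'a \<Rightarrow> real"
  assumes h: "integrable M h"
  shows "integrable signed (\<lambda>(x, e). e * h x)"
proof (rule integrable_signed_bound)
  show "integrable M (\<lambda>x. \<bar>h x\<bar>)" using h by simp
  show "(\<lambda>(x, e). e * h x) \<in> borel_measurable signed" using h by (intro measurable_signed) simp
qed simp_all

lemma integral_signed:
  fixes F :: "'a \<times> real \<Rightarrow> real"
  assumes F: "integrable signed F"
    and "integrable M (\<lambda>x. F (x, 1))" "integrable M (\<lambda>x. F (x, -1))"
  shows "(\<integral>p. F p \<partial>signed) = ((\<integral>x. F (x, 1) \<partial>M) + (\<integral>x. F (x, -1) \<partial>M)) / 2"
proof -
  interpret P: pair_prob_space M "measure_pmf (pmf_of_set {-1, 1::real})" ..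
  have "(\<integral>p. F p \<partial>signed) = (\<integral>x. (\<integral>e. F (x, e) \<partial>pmf_of_set {-1, 1::real}) \<partial>M)"
    using P.integral_fst'[OF F[unfolded signed_def]] by (simp add: signed_def)
  also have "\<dots> = (\<integral>x. (F (x, 1) + F (x, -1)) / 2 \<partial>M)"
    by (subst integral_pmf_of_set) (auto simp: add.commute)
  finally show ?thesis using assms by simp
qed

text \<open>One coordinate of the symmetrisation and contraction argument.  Both are done in a single step,
  so that the passage to product measures is an induction in which \<open>a\<close> absorbs the other
  coordinates.\<close>

lemma symmetrise_contract:
  fixes f h :: "'t \<Rightarrow> 'a \<Rightarrow> real" and a :: "'t \<Rightarrow> real"
  assumes T: "finite T" "T \<noteq> {}"
    and f: "\<And>t. t \<in> T \<Longrightarrow> integrable M (f t)"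
    and h: "\<And>t. t \<in> T \<Longrightarrow> integrable M (h t)"
    and fh: "\<And>s t x. s \<in> T \<Longrightarrow> t \<in> T \<Longrightarrow> x \<in> space M \<Longrightarrow> \<bar>f s x - f t x\<bar> \<le> \<bar>h s x - h t x\<bar>"
  shows "(\<integral>x. (MAX t\<in>T. a t + ((\<integral>y. f t y \<partial>M) - f t x)) \<partial>M)
    \<le> (\<integral>(x, e). (MAX t\<in>T. a t + 2 * (e * h t x)) \<partial>signed)"
proof -
  let ?U = "\<lambda>g x. MAX t\<in>T. a t + 2 * g t x" and ?V = "\<lambda>g x. MAX t\<in>T. a t - 2 * g t x"
  interpret S: prob_space signed by (rule prob_space_signed)
  have int: "integrable M (?U f)" "integrable M (?V f)" "integrable M (?U h)" "integrable M (?V h)"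
    using f h by (auto intro!: integrable_MAX T)
  \<comment> \<open>The expression is half of
    \<open>a t + 2 * (\<integral>y. f t y \<partial>M)\<close> plus half of
    \<open>a t - 2 * f t x\<close>. Letting each half choose its own maximiser decouples them, and
    the integration variable \<open>y\<close> acts as the independent copy. This is the origin of
    the factor 2 in the statement.\<close>
  have 1: "(MAX t\<in>T. a t + ((\<integral>y. f t y \<partial>M) - f t x)) \<le> (\<integral>y. ?U f y \<partial>M) / 2 + ?V f x / 2" for x
  proof -
    obtain t where t: "t \<in> T" "(MAX t\<in>T. a t + ((\<integral>y. f t y \<partial>M) - f t x)) = a t + ((\<integral>y. f t y \<partial>M) - f t x)"
      by (rule MAX_attained[OF T])
    have "a t + 2 * f t y \<le> ?U f y" for y
      using T t(1) by (intro Max_ge) auto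
    then have "(\<integral>y. a t + 2 * f t y \<partial>M) \<le> (\<integral>y. ?U f y \<partial>M)"
      using f[OF t(1)] int by (intro integral_mono) auto
    then have "a t + 2 * (\<integral>y. f t y \<partial>M) \<le> (\<integral>y. ?U f y \<partial>M)"
      using f[OF t(1)] by (simp add: prob_space)
    moreover have "a t - 2 * f t x \<le> ?V f x"
      using T t(1) by (intro Max_ge) auto
    ultimately show ?thesis using t(2) by simp
  qed
  \<comment> \<open>Contraction for a single sign: with maximisers \<open>s\<close> and
    \<open>t\<close>, only \<open>f s x - f t x\<close> enters, and it is at most
    \<open>\<bar>h s x - h t x\<bar>\<close>. Depending on the sign inside the absolute value, the
    pair \<open>s\<close>, \<open>t\<close> or the pair \<open>t\<close>, \<open>s\<close> serves as
    competitors on the right.\<close>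
  have 2: "?U f x + ?V f x \<le> ?U h x + ?V h x" if x: "x \<in> space M" for x
  proof -
    obtain s where s: "s \<in> T" "?U f x = a s + 2 * f s x" by (rule MAX_attained[OF T])
    obtain t where t: "t \<in> T" "?V f x = a t - 2 * f t x" by (rule MAX_attained[OF T])
    have "a s + 2 * h s x \<le> ?U h x" "a t + 2 * h t x \<le> ?U h x"
      "a s - 2 * h s x \<le> ?V h x" "a t - 2 * h t x \<le> ?V h x"
      using T s(1) t(1) by (auto intro!: Max_ge)
    then show ?thesis using fh[OF s(1) t(1) x] s(2) t(2) by linarith
  qed
  have "(\<integral>x. (MAX t\<in>T. a t + ((\<integral>y. f t y \<partial>M) - f t x)) \<partial>M) \<le> (\<integral>x. (\<integral>y. ?U f y \<partial>M) / 2 + ?V f x / 2 \<partial>M)"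
    using 1 int f by (intro integral_mono integrable_MAX T) auto
  also have "\<dots> = (\<integral>x. (?U f x + ?V f x) / 2 \<partial>M)"
    using int by (simp add: prob_space add_divide_distrib)
  also have "\<dots> \<le> (\<integral>x. (?U h x + ?V h x) / 2 \<partial>M)"
    by (intro integral_mono divide_right_mono 2) (use int in auto)
  also have "\<dots> = (\<integral>(x, e). (MAX t\<in>T. a t + 2 * (e * h t x)) \<partial>signed)"
  proof -
    have "integrable signed (\<lambda>p. MAX t\<in>T. a t + 2 * (case p of (x, e) \<Rightarrow> e * h t x))"
      using integrable_signed h by (intro integrable_MAX T) auto
    then have "integrable signed (\<lambda>(x, e). MAX t\<in>T. a t + 2 * (e * h t x))"
      by (simp add: case_prod_beta')
    from integral_signed[OF this] show ?thesis
      using int by simp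
  qed
  finally show ?thesis .
qed

lemma integrable_PiM_component:
  fixes f :: "'a \<Rightarrow> real"
  assumes "integrable M f" "i \<in> I"
  shows "integrable (PiM I (\<lambda>_. M)) (\<lambda>X. f (X i))"
proof -
  interpret product_prob_space "\<lambda>_. M" I ..
  have "integrable (distr (PiM I (\<lambda>_. M)) M (\<lambda>X. X i)) f"
    using assms PiM_component[of i] by simp
  from integrable_distr[OF _ this] show ?thesis using assms by simp
qed

lemma symmetrise_contract_PiM:
  fixes f h :: "'t \<Rightarrow> 'a \<Rightarrow> real" and a :: "'t \<Rightarrow> real"
  assumes T: "finite T" "T \<noteq> {}" and I: "finite I"
    and f: "\<And>t. t \<in> T \<Longrightarrow> integrable M (f t)"
    and h: "\<And>t. t \<in> T \<Longrightarrow> integrable M (h t)"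
    and fh: "\<And>s t x. s \<in> T \<Longrightarrow> t \<in> T \<Longrightarrow> x \<in> space M \<Longrightarrow> \<bar>f s x - f t x\<bar> \<le> \<bar>h s x - h t x\<bar>"
  shows "(\<integral>X. (MAX t\<in>T. a t + (\<Sum>i\<in>I. (\<integral>y. f t y \<partial>M) - f t (X i))) \<partial>PiM I (\<lambda>_. M))
    \<le> (\<integral>Y. (MAX t\<in>T. a t + (\<Sum>i\<in>I. 2 * (case Y i of (x, e) \<Rightarrow> e * h t x))) \<partial>PiM I (\<lambda>_. signed))"
  using I
proof (induct I arbitrary: a)
  case empty
  interpret Q: prob_space "PiM {} (\<lambda>_. M)" by (rule prob_space_PiM_const)
  interpret S: prob_space signed by (rule prob_space_signed)
  interpret R: prob_space "PiM {} (\<lambda>_. signed)" by (rule S.prob_space_PiM_const)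
  show ?case
    by (simp only: sum.empty add_0_right lebesgue_integral_const Q.prob_space R.prob_space scaleR_one order_refl)
next
  case (insert i I)
  interpret S: prob_space signed by (rule prob_space_signed)
  let ?Q = "PiM I (\<lambda>_. M)" and ?R = "PiM I (\<lambda>_. signed)"
  interpret P: pair_prob_space M ?Q by (rule pair_prob_space_PiM_const)
  interpret PS: pair_prob_space signed ?R by (rule S.pair_prob_space_PiM_const)
  interpret PX: pair_prob_space signed ?Q ..
  interpret ZM: prob_space "PiM (insert i I) (\<lambda>_. M)" by (rule prob_space_PiM_const)
  interpret WM: prob_space "PiM (insert i I) (\<lambda>_. signed)" by (rule S.prob_space_PiM_const)
  define F where "F t x = (\<integral>y. f t y \<partial>M) - f t x" for t x
  define G where "G t p = 2 * (case p of (x, e) \<Rightarrow> e * h t x)" for t p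
  have F: "integrable M (F t)" if "t \<in> T" for t
    unfolding F_def using f[OF that] by simp
  have G: "integrable signed (G t)" if "t \<in> T" for t
    unfolding G_def using integrable_signed[OF h[OF that]] by simp
  have sF: "integrable (PiM J (\<lambda>_. M)) (\<lambda>X. \<Sum>j\<in>J. F t (X j))" if "t \<in> T" for t and J :: "'b set"
    by (intro Bochner_Integration.integrable_sum integrable_PiM_component F that)
  have sG: "integrable (PiM J (\<lambda>_. signed)) (\<lambda>X. \<Sum>j\<in>J. G t (X j))" if "t \<in> T" for t and J :: "'b set"
    by (intro Bochner_Integration.integrable_sum S.integrable_PiM_component G that)
  define Z where "Z X = (MAX t\<in>T. a t + (\<Sum>j\<in>insert i I. F t (X j)))" for X
  define W where "W X = (MAX t\<in>T. a t + (\<Sum>j\<in>insert i I. G t (X j)))" for X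
  have Z: "integrable (PiM (insert i I) (\<lambda>_. M)) Z"
    unfolding Z_def
    by (intro integrable_MAX T Bochner_Integration.integrable_add sF) simp
  have W: "integrable (PiM (insert i I) (\<lambda>_. signed)) W"
    unfolding W_def
    by (intro integrable_MAX T Bochner_Integration.integrable_add sG) simp
  have Zeq: "Z (X(i := x)) = (MAX t\<in>T. (a t + (\<Sum>j\<in>I. F t (X j))) + F t x)" for X x
    unfolding Z_def sum_insert_fun_upd[OF insert(1,2)] by (simp add: algebra_simps)
  have Weq: "W (X(i := x)) = (MAX t\<in>T. (a t + G t x) + (\<Sum>j\<in>I. G t (X j)))" for X x
    unfolding W_def sum_insert_fun_upd[OF insert(1,2)] by (simp add: algebra_simps)
  \<comment> \<open>Hybrid between \<open>Z\<close> and \<open>W\<close>: coordinate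
    \<open>i\<close> is already signed, those in \<open>I\<close> are not. The one-coordinate lemma
    leads from \<open>Z\<close> to \<open>V\<close>, the induction hypothesis with
    \<open>G t p\<close> added to the offset from \<open>V\<close> to \<open>W\<close>.\<close>
  define V where "V p X = (MAX t\<in>T. (a t + (\<Sum>j\<in>I. F t (X j))) + G t p)" for p X
  have Vint: "integrable (signed \<Otimes>\<^sub>M ?Q) (\<lambda>(p, X). V p X)"
  proof -
    have "integrable (signed \<Otimes>\<^sub>M ?Q) (\<lambda>q. (a t + (\<Sum>j\<in>I. F t (snd q j))) + G t (fst q))" if "t \<in> T" for t
      using PX.integrable_pair_fst[OF G[OF that]] PX.integrable_pair_snd[OF sF[OF that]] by simp
    then show ?thesis unfolding V_def case_prod_beta' by (intro integrable_MAX T)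
  qed
  have Zi: "integrable (M \<Otimes>\<^sub>M ?Q) (\<lambda>(x, X). Z (X(i := x)))"
    by (rule integrable_PiM_insert[OF Z])
  have Wi: "integrable (signed \<Otimes>\<^sub>M ?R) (\<lambda>(x, X). W (X(i := x)))"
    by (rule S.integrable_PiM_insert[OF W])
  have "(\<integral>X. Z X \<partial>PiM (insert i I) (\<lambda>_. M)) = (\<integral>(x, X). Z (X(i := x)) \<partial>(M \<Otimes>\<^sub>M ?Q))"
    using Z by (subst integral_PiM_insert) auto
  also have "\<dots> = (\<integral>X. (\<integral>x. Z (X(i := x)) \<partial>M) \<partial>?Q)"
    using P.integral_snd[OF Zi] by simp
  also have "\<dots> \<le> (\<integral>X. (\<integral>p. V p X \<partial>signed) \<partial>?Q)"
  proof (rule integral_mono)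
    show "integrable ?Q (\<lambda>X. \<integral>x. Z (X(i := x)) \<partial>M)" by (rule P.integrable_snd[OF Zi])
    show "integrable ?Q (\<lambda>X. \<integral>p. V p X \<partial>signed)" by (rule PX.integrable_snd[OF Vint])
    fix X assume "X \<in> space ?Q"
    show "(\<integral>x. Z (X(i := x)) \<partial>M) \<le> (\<integral>p. V p X \<partial>signed)"
      unfolding Zeq V_def G_def case_prod_beta'
      using symmetrise_contract[where f=f and h=h and a="\<lambda>t. a t + (\<Sum>j\<in>I. F t (X j))", OF T]
        f h fh by (simp add: F_def case_prod_beta')
  qed
  also have "\<dots> = (\<integral>p. (\<integral>X. V p X \<partial>?Q) \<partial>signed)"
    using PX.Fubini_integral[OF Vint] by simp
  also have "\<dots> \<le> (\<integral>p. (\<integral>X. W (X(i := p)) \<partial>?R) \<partial>signed)"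
  proof (rule integral_mono)
    show "integrable signed (\<lambda>p. \<integral>X. V p X \<partial>?Q)" by (rule PX.integrable_fst[OF Vint])
    show "integrable signed (\<lambda>p. \<integral>X. W (X(i := p)) \<partial>?R)" by (rule PS.integrable_fst[OF Wi])
    fix p assume "p \<in> space signed"
    have "V p X = (MAX t\<in>T. (a t + G t p) + (\<Sum>j\<in>I. F t (X j)))" for X
      unfolding V_def by (simp add: algebra_simps)
    then show "(\<integral>X. V p X \<partial>?Q) \<le> (\<integral>X. W (X(i := p)) \<partial>?R)"
      unfolding Weq using insert(3)[of "\<lambda>t. a t + G t p"] by (simp add: F_def G_def)
  qed
  also have "\<dots> = (\<integral>X. W X \<partial>PiM (insert i I) (\<lambda>_. signed))"
    using PS.integral_fst[OF Wi] W by (subst S.integral_PiM_insert) auto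
  finally show ?case unfolding Z_def W_def F_def G_def .
qed

end

section \<open>Bernstein variables and truncation\<close>

context prob_space
begin

text \<open>The series of \<open>cosh\<close> has only even terms, so no centring of
  \<open>Z\<close> is required: after the constant term, every moment has order at least 2 and falls
  under the Bernstein condition. The factorials cancel and leave a geometric series of ratio
  \<open>l * K\<close>. Working with nonnegative integrals yields integrability along with the
  bound.\<close>

lemma bernstein_cosh:
  assumes Z: "bernstein M Z \<sigma> K" and "K \<ge> 0" "l \<ge> 0" "l * K < 1"
  shows "integrable M (\<lambda>x. cosh (l * Z x))"
    and "(\<integral>x. cosh (l * Z x) \<partial>M) \<le> exp (l\<^sup>2 * \<sigma>\<^sup>2 / (2 * (1 - l * K)))"
proof -
  have [measurable]: "Z \<in> borel_measurable M" using Z by (simp add: bernstein_def)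
  \<comment> \<open>Majorant for the integral of the \<open>n\<close>-th term. The odd terms from 3
    on are kept although the series of \<open>cosh\<close> lacks them, so that the tail from 2 on is
    exactly geometric.\<close>
  define g where "g n = (if n = 0 then 1 else if n = 1 then 0 else l ^ n * K ^ (n - 2) * \<sigma>\<^sup>2 / 2)" for n
  define b where "b n y = (if even n then y ^ n / fact n else (0::real))" for n y
  have b0: "0 \<le> b n y" for n y by (auto simp: b_def zero_le_even_power)
  have [measurable]: "b n \<in> borel_measurable borel" for n unfolding b_def by measurable
  have g0: "0 \<le> g n" for n using assms by (auto simp: g_def)
  define v where "v = l\<^sup>2 * \<sigma>\<^sup>2 / (2 * (1 - l * K))"
  have v0: "0 \<le> v" using assms by (simp add: v_def)
  have "(\<lambda>n. (l\<^sup>2 * \<sigma>\<^sup>2 / 2) * (l * K) ^ n) sums ((l\<^sup>2 * \<sigma>\<^sup>2 / 2) * (1 / (1 - l * K)))"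
    using assms by (intro sums_mult geometric_sums) (simp add: abs_mult)
  then have "(\<lambda>n. g (n + 2)) sums v"
    by (simp add: g_def v_def power_add power_mult_distrib power2_eq_square mult_ac)
  then have gs: "g sums (1 + v)"
    using sums_iff_shift[of g 2 v] by (simp add: g_def numeral_2_eq_2 add.commute)
  have le: "(\<integral>\<^sup>+x. ennreal (b n (l * Z x)) \<partial>M) \<le> ennreal (g n)" for n
  proof (cases "n \<ge> 2 \<and> even n")
    case False
    then consider "n = 0" | "n = 1" | "odd n" by linarith
    then show ?thesis
      by cases (auto simp: b_def g_def emeasure_space_1)
  next
    case True
    have "(\<integral>\<^sup>+x. ennreal (b n (l * Z x)) \<partial>M) = (\<integral>\<^sup>+x. ennreal (l ^ n / fact n * \<bar>Z x\<bar> ^ n) \<partial>M)"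
      using True by (intro nn_integral_cong) (simp add: b_def power_mult_distrib power_even_abs)
    also have "\<dots> = ennreal (\<integral>x. l ^ n / fact n * \<bar>Z x\<bar> ^ n \<partial>M)"
      using Z True assms by (intro nn_integral_eq_integral) (auto simp: bernstein_def)
    also have "(\<integral>x. l ^ n / fact n * \<bar>Z x\<bar> ^ n \<partial>M) = l ^ n / fact n * (\<integral>x. \<bar>Z x\<bar> ^ n \<partial>M)"
      by simp
    also have "\<dots> \<le> l ^ n / fact n * (fact n / 2 * K ^ (n - 2) * \<sigma>\<^sup>2)"
      using Z True assms by (intro mult_left_mono) (auto simp: bernstein_def)
    also have "\<dots> = g n" using True by (auto simp: g_def)
    finally show ?thesis by (simp add: ennreal_leI)
  qed
  have cosh: "ennreal (cosh y) = (\<Sum>n. ennreal (b n y))" for y :: real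
  proof -
    have "(\<lambda>n. b n y) sums cosh y"
      using cosh_converges[of y] by (simp add: b_def scaleR_conv_of_real field_simps cong: if_cong)
    then show ?thesis by (rule suminf_ennreal_eq[OF b0, symmetric])
  qed
  have "(\<integral>\<^sup>+x. ennreal (cosh (l * Z x)) \<partial>M) = (\<Sum>n. \<integral>\<^sup>+x. ennreal (b n (l * Z x)) \<partial>M)"
    unfolding cosh by (intro nn_integral_suminf) measurable
  also have "\<dots> \<le> (\<Sum>n. ennreal (g n))"
    by (intro suminf_le le) auto
  also have "\<dots> = ennreal (1 + v)"
    by (rule suminf_ennreal_eq[OF g0 gs])
  finally have nn: "(\<integral>\<^sup>+x. ennreal (cosh (l * Z x)) \<partial>M) \<le> ennreal (1 + v)" .
  show int: "integrable M (\<lambda>x. cosh (l * Z x))"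
  proof (rule integrableI_nonneg)
    show "(\<integral>\<^sup>+x. ennreal (cosh (l * Z x)) \<partial>M) < \<infinity>"
      using nn by (simp add: order_le_less_trans)
    have "cosh \<in> borel_measurable (borel :: real measure)"
      by (intro borel_measurable_continuous_onI continuous_intros)
    then show "(\<lambda>x. cosh (l * Z x)) \<in> borel_measurable M" by measurable
  qed (auto simp: cosh_real_nonneg)
  have "ennreal (\<integral>x. cosh (l * Z x) \<partial>M) \<le> ennreal (1 + v)"
    using nn nn_integral_eq_integral[OF int] by (simp add: cosh_real_nonneg)
  then have "(\<integral>x. cosh (l * Z x) \<partial>M) \<le> 1 + v" using v0 by (subst (asm) ennreal_le_iff) auto
  also have "\<dots> \<le> exp v" by (rule exp_ge_add_one_self)
  finally show "(\<integral>x. cosh (l * Z x) \<partial>M) \<le> exp (l\<^sup>2 * \<sigma>\<^sup>2 / (2 * (1 - l * K)))" by (simp add: v_def)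
qed

text \<open>Layer cake: the part of \<open>(Z x)\<^sup>2\<close> above \<open>K\<^sup>2\<close> is
  the integral of \<open>2 * t\<close> from \<open>K\<close> to \<open>\<bar>Z x\<bar>\<close>. By
  Fubini and the tail bound, the mean loss is at most the integral of
  \<open>2 * C powr m * t powr (1 - m)\<close> over \<open>t \<ge> K\<close>, which converges
  because \<open>m > 2\<close>.\<close>

lemma truncated_second_moment_ge:
  assumes [measurable]: "Z \<in> borel_measurable M" and Z2: "integrable M (\<lambda>x. (Z x)\<^sup>2)"
    and tail: "\<And>t. t > 0 \<Longrightarrow> \<P>(x in M. \<bar>Z x\<bar> > t) \<le> (C / t) powr m"
    and "m > 2" "C \<ge> 0" "K > 0"
  shows "(\<integral>x. min ((Z x)\<^sup>2) (K\<^sup>2) \<partial>M) \<ge> (\<integral>x. (Z x)\<^sup>2 \<partial>M) - 2 * C powr m * K powr (2 - m) / (m - 2)"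
proof -
  interpret P: pair_sigma_finite M lborel ..
  define h where "h t x = ennreal (if K \<le> t \<and> t < \<bar>Z x\<bar> then 2 * t else 0)" for t x
  have [measurable]: "(\<lambda>(x, t). h t x) \<in> borel_measurable (M \<Otimes>\<^sub>M lborel)"
    unfolding h_def by measurable
  define D where "D x = (Z x)\<^sup>2 - min ((Z x)\<^sup>2) (K\<^sup>2)" for x
  have D0: "D x \<ge> 0" for x by (simp add: D_def)
  have Dh: "ennreal (D x) = (\<integral>\<^sup>+t. h t x \<partial>lborel)" for x
  proof (cases "\<bar>Z x\<bar> \<ge> K")
    case True
    have "(\<integral>\<^sup>+t. h t x \<partial>lborel) = (\<integral>\<^sup>+t. ennreal (2 * t) * indicator {K..\<bar>Z x\<bar>} t \<partial>lborel)"
      using AE_lborel_singleton[of "\<bar>Z x\<bar>"]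
      by (intro nn_integral_cong_AE) (auto elim!: eventually_mono simp: h_def indicator_def)
    also have "\<dots> = ennreal (\<bar>Z x\<bar>\<^sup>2 - K\<^sup>2)"
      using True \<open>K > 0\<close>
      by (intro nn_integral_FTC_Icc) (auto intro!: derivative_eq_intros)
    also have "\<bar>Z x\<bar>\<^sup>2 - K\<^sup>2 = D x"
      using True \<open>K > 0\<close> power_mono[of K "\<bar>Z x\<bar>" 2] by (simp add: D_def min_def)
    finally show ?thesis ..
  next
    case False
    then have "(Z x)\<^sup>2 \<le> K\<^sup>2"
      using power_mono[of "\<bar>Z x\<bar>" K 2] by simp
    then have "D x = 0" by (simp add: D_def)
    moreover have "h t x = 0" for t using False by (simp add: h_def)
    ultimately show ?thesis by simp
  qed
  define \<beta> where "\<beta> = 2 * C powr m * K powr (2 - m) / (m - 2)"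
  have "(\<integral>\<^sup>+x. ennreal (D x) \<partial>M) = (\<integral>\<^sup>+t. (\<integral>\<^sup>+x. h t x \<partial>M) \<partial>lborel)"
    unfolding Dh by (intro P.Fubini'[of "\<lambda>x t. h t x", symmetric]) measurable
  also have "\<dots> \<le> (\<integral>\<^sup>+t. ennreal (2 * C powr m * t powr (1 - m)) * indicator {K..} t \<partial>lborel)"
  proof (intro nn_integral_mono)
    fix t :: real
    show "(\<integral>\<^sup>+x. h t x \<partial>M) \<le> ennreal (2 * C powr m * t powr (1 - m)) * indicator {K..} t"
    proof (cases "K \<le> t")
      case True
      then have t: "t > 0" using \<open>K > 0\<close> by simp
      have "(\<integral>\<^sup>+x. h t x \<partial>M) = (\<integral>\<^sup>+x. ennreal (2 * t) * indicator {x \<in> space M. t < \<bar>Z x\<bar>} x \<partial>M)"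
        using True by (intro nn_integral_cong) (auto simp: h_def)
      also have "\<dots> = ennreal (2 * t) * ennreal (\<P>(x in M. \<bar>Z x\<bar> > t))"
        by (subst nn_integral_cmult_indicator) (auto simp: emeasure_eq_measure)
      also have "\<dots> \<le> ennreal (2 * t) * ennreal ((C / t) powr m)"
        using tail[OF t] by (intro mult_left_mono ennreal_leI) auto
      also have "\<dots> = ennreal (2 * t * (C / t) powr m)"
        using t by (simp add: ennreal_mult)
      also have "2 * t * (C / t) powr m = 2 * C powr m * t powr (1 - m)"
        using t \<open>C \<ge> 0\<close> by (simp add: powr_divide powr_diff)
      finally show ?thesis using True by simp
    next
      case False
      then show ?thesis by (simp add: h_def)
    qed
  qed
  also have "\<dots> = ennreal (0 - (- 2 * C powr m * K powr (2 - m) / (m - 2)))"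
  proof (rule nn_integral_FTC_atLeast)
    fix t assume "K \<le> t"
    then have t: "t > 0" using \<open>K > 0\<close> by simp
    show "((\<lambda>t. - 2 * C powr m * t powr (2 - m) / (m - 2)) has_real_derivative 2 * C powr m * t powr (1 - m)) (at t)"
    proof (rule DERIV_cong)
      show "((\<lambda>t. - 2 * C powr m * t powr (2 - m) / (m - 2)) has_real_derivative
          - 2 * C powr m * ((2 - m) * t powr (2 - m - 1)) / (m - 2)) (at t)"
        by (intro DERIV_cdivide DERIV_cmult has_real_derivative_powr t)
      show "- 2 * C powr m * ((2 - m) * t powr (2 - m - 1)) / (m - 2) = 2 * C powr m * t powr (1 - m)"
        using \<open>m > 2\<close> by (simp add: field_simps)
    qed
    show "0 \<le> 2 * C powr m * t powr (1 - m)" by simp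
  next
    have "((\<lambda>t::real. t powr (2 - m)) \<longlongrightarrow> 0) at_top"
      using \<open>m > 2\<close> by (intro tendsto_neg_powr filterlim_ident) auto
    then have "((\<lambda>t::real. - 2 * C powr m * t powr (2 - m) / (m - 2)) \<longlongrightarrow> - 2 * C powr m * 0 / (m - 2)) at_top"
      by (intro tendsto_intros) (use \<open>m > 2\<close> in auto)
    then show "((\<lambda>t::real. - 2 * C powr m * t powr (2 - m) / (m - 2)) \<longlongrightarrow> 0) at_top" by simp
  qed simp
  finally have nn: "(\<integral>\<^sup>+x. ennreal (D x) \<partial>M) \<le> ennreal \<beta>" by (simp add: \<beta>_def)
  have mint: "integrable M (\<lambda>x. min ((Z x)\<^sup>2) (K\<^sup>2))"
    by (intro integrable_const_bound[where B="K\<^sup>2"]) auto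
  then have Dint: "integrable M D" unfolding D_def using Z2 by simp
  have "ennreal (\<integral>x. D x \<partial>M) \<le> ennreal \<beta>"
    using nn nn_integral_eq_integral[OF Dint] D0 by simp
  moreover have "\<beta> \<ge> 0" using \<open>m > 2\<close> by (simp add: \<beta>_def)
  ultimately have "(\<integral>x. D x \<partial>M) \<le> \<beta>" by simp
  then show ?thesis using mint Z2 by (simp add: D_def \<beta>_def)
qed

lemma bernstein_integrable:
  assumes "bernstein M Z \<sigma> K"
  shows "integrable M Z"
proof (rule square_integrable_imp_integrable)
  show "Z \<in> borel_measurable M" using assms by (simp add: bernstein_def)
  have "integrable M (\<lambda>x. \<bar>Z x\<bar> ^ 2)" using assms unfolding bernstein_def by blast
  then show "integrable M (\<lambda>x. (Z x)\<^sup>2)" by simp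
qed

text \<open>Averaging over the sign turns the exponential into \<open>cosh\<close>, which is even.
  Both signs of \<open>c\<close> therefore obey the same bound, as needed for absolute values of
  signed sums.\<close>

lemma exp_signed:
  assumes Z: "bernstein M Z \<sigma> K" and K: "K \<ge> 0" "l \<ge> 0" "l * K < 1" and c: "c = l \<or> c = - l"
  shows "integrable signed (\<lambda>(x, e). exp (c * (e * Z x)))"
    and "(\<integral>(x, e). exp (c * (e * Z x)) \<partial>signed) \<le> exp (l\<^sup>2 * \<sigma>\<^sup>2 / (2 * (1 - l * K)))"
proof -
  have [measurable]: "Z \<in> borel_measurable M" using Z by (simp add: bernstein_def)
  have ch: "exp y + exp (- y) = 2 * cosh y" for y :: real by (simp add: cosh_field_def)
  have cosh: "integrable M (\<lambda>x. 2 * cosh (l * Z x))"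
    using bernstein_cosh(1)[OF Z K] by simp
  have le: "exp (l * Z x) \<le> 2 * cosh (l * Z x)" "exp (- (l * Z x)) \<le> 2 * cosh (l * Z x)" for x
    using ch[of "l * Z x"] exp_gt_zero[of "l * Z x"] exp_gt_zero[of "- (l * Z x)"] by linarith+
  have i1: "integrable M (\<lambda>x. exp (l * Z x))"
    by (rule Bochner_Integration.integrable_bound[OF cosh]) (use le in \<open>auto simp: cosh_real_nonneg\<close>)
  have i2: "integrable M (\<lambda>x. exp (- (l * Z x)))"
    by (rule Bochner_Integration.integrable_bound[OF cosh]) (use le in \<open>auto simp: cosh_real_nonneg\<close>)
  show int: "integrable signed (\<lambda>(x, e). exp (c * (e * Z x)))"
  proof (rule integrable_signed_bound[OF _ cosh])
    show "(\<lambda>(x, e). exp (c * (e * Z x))) \<in> borel_measurable signed"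
      using measurable_compose[OF measurable_signed, of Z "\<lambda>y. exp (c * y)" borel]
      by (simp add: case_prod_beta')
  qed (use c le in auto)
  have "(\<integral>(x, e). exp (c * (e * Z x)) \<partial>signed) = ((\<integral>x. exp (l * Z x) \<partial>M) + (\<integral>x. exp (- (l * Z x)) \<partial>M)) / 2"
    by (subst integral_signed[OF int]) (use c i1 i2 in auto)
  also have "\<dots> = (\<integral>x. exp (l * Z x) + exp (- (l * Z x)) \<partial>M) / 2"
    using i1 i2 by simp
  also have "\<dots> = (\<integral>x. cosh (l * Z x) \<partial>M)"
    by (simp add: ch)
  finally show "(\<integral>(x, e). exp (c * (e * Z x)) \<partial>signed) \<le> exp (l\<^sup>2 * \<sigma>\<^sup>2 / (2 * (1 - l * K)))"
    using bernstein_cosh(2)[OF Z K] by simp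
qed

text \<open>The exponential of \<open>l\<close> times the maximum is at most the sum of the
  \<open>2 * card J\<close> exponentials with both signs, and each of these factorises over the
  independent coordinates.\<close>

lemma bernstein_maximal_aux:
  fixes Z :: "'j \<Rightarrow> 'a \<Rightarrow> real"
  assumes J: "finite J" "J \<noteq> {}" and I: "finite I"
    and Z: "\<And>j. j \<in> J \<Longrightarrow> bernstein M (Z j) \<sigma> K" and K: "K \<ge> 0" "l > 0" "l * K < 1"
  shows "integrable (PiM I (\<lambda>_. signed)) (\<lambda>Y. MAX j\<in>J. \<bar>\<Sum>i\<in>I. case Y i of (x, e) \<Rightarrow> e * Z j x\<bar>)"
    and "(\<integral>Y. (MAX j\<in>J. \<bar>\<Sum>i\<in>I. case Y i of (x, e) \<Rightarrow> e * Z j x\<bar>) \<partial>PiM I (\<lambda>_. signed))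
    \<le> (ln (2 * real (card J)) + real (card I) * (l\<^sup>2 * \<sigma>\<^sup>2 / (2 * (1 - l * K)))) / l"
proof -
  interpret S: prob_space signed by (rule prob_space_signed)
  let ?R = "PiM I (\<lambda>_. signed)"
  interpret R: prob_space ?R by (rule S.prob_space_PiM_const)
  interpret PS: product_prob_space "\<lambda>_. signed" I ..
  define s where "s j Y = (\<Sum>i\<in>I. case Y i of (x, e) \<Rightarrow> e * Z j x)" for j Y
  define v where "v = l\<^sup>2 * \<sigma>\<^sup>2 / (2 * (1 - l * K))"
  have K': "l \<ge> 0" using K by simp
  have ex: "integrable ?R (\<lambda>Y. exp (c * s j Y))" "(\<integral>Y. exp (c * s j Y) \<partial>?R) \<le> exp (real (card I) * v)"
    if j: "j \<in> J" and c: "c = l \<or> c = - l" for j c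
  proof -
    have eq: "exp (c * s j Y) = (\<Prod>i\<in>I. case Y i of (x, e) \<Rightarrow> exp (c * (e * Z j x)))" for Y
      by (simp add: s_def sum_distrib_left exp_sum[OF I] case_prod_beta')
    note es = exp_signed[OF Z[OF j] K(1) K' K(3) c]
    show "integrable ?R (\<lambda>Y. exp (c * s j Y))"
      unfolding eq by (rule PS.product_integrable_prod[OF I es(1)])
    have "(\<integral>Y. exp (c * s j Y) \<partial>?R) = (\<Prod>i\<in>I. (\<integral>(x, e). exp (c * (e * Z j x)) \<partial>signed))"
      unfolding eq by (rule PS.product_integral_prod[OF I es(1)])
    also have "\<dots> \<le> (\<Prod>i\<in>I. exp v)"
      using es(2) by (intro prod_mono) (auto simp: v_def intro!: Bochner_Integration.integral_nonneg)
    also have "\<dots> = exp (real (card I) * v)"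
      by (simp add: exp_of_nat_mult)
    finally show "(\<integral>Y. exp (c * s j Y) \<partial>?R) \<le> exp (real (card I) * v)" .
  qed
  have sint: "integrable ?R (s j)" if "j \<in> J" for j
  proof -
    have "integrable M (Z j)" by (rule bernstein_integrable[OF Z[OF that]])
    then show ?thesis
      unfolding s_def
      by (intro Bochner_Integration.integrable_sum S.integrable_PiM_component integrable_signed)
  qed
  show "integrable ?R (\<lambda>Y. MAX j\<in>J. \<bar>\<Sum>i\<in>I. case Y i of (x, e) \<Rightarrow> e * Z j x\<bar>)"
    using sint unfolding s_def[symmetric] by (intro integrable_MAX J) auto
  define W where "W Y = (\<Sum>j\<in>J. exp (l * s j Y) + exp (- l * s j Y))" for Y
  define w0 where "w0 = 2 * real (card J) * exp (real (card I) * v)"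
  have J1: "card J \<ge> 1" using J by (simp add: Suc_leI card_gt_0_iff)
  then have w0: "w0 > 0" by (simp add: w0_def)
  have ex1: "integrable ?R (\<lambda>Y. exp (l * s j Y))" "integrable ?R (\<lambda>Y. exp (- l * s j Y))" if "j \<in> J" for j
    by (rule ex(1)[OF that], simp)+
  have Wint: "integrable ?R W"
    unfolding W_def by (intro Bochner_Integration.integrable_sum Bochner_Integration.integrable_add ex1)
  have "(\<integral>Y. W Y \<partial>?R) = (\<Sum>j\<in>J. (\<integral>Y. exp (l * s j Y) \<partial>?R) + (\<integral>Y. exp (- l * s j Y) \<partial>?R))"
    unfolding W_def
    by (subst Bochner_Integration.integral_sum)
       (intro Bochner_Integration.integrable_add ex1 sum.cong refl Bochner_Integration.integral_add; assumption)+
  also have "\<dots> \<le> (\<Sum>j\<in>J. exp (real (card I) * v) + exp (real (card I) * v))"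
    by (intro sum_mono add_mono ex(2)) auto
  also have "\<dots> = w0" by (simp add: w0_def)
  finally have EW: "(\<integral>Y. W Y \<partial>?R) \<le> w0" .
  \<comment> \<open>In place of Jensen's inequality, the tangent of \<open>ln\<close> at
    \<open>w0\<close> gives a pointwise bound that is affine in \<open>W Y\<close>. As the mean of
    \<open>W\<close> is at most \<open>w0\<close>, its terms beyond \<open>ln w0\<close> have
    nonpositive mean.\<close>
  have pt: "(MAX j\<in>J. \<bar>s j Y\<bar>) \<le> (ln w0 + W Y / w0 - 1) / l" for Y
  proof -
    obtain j where j: "j \<in> J" "(MAX j\<in>J. \<bar>s j Y\<bar>) = \<bar>s j Y\<bar>" by (rule MAX_attained[OF J])
    have "exp (l * \<bar>s j Y\<bar>) \<le> exp (l * s j Y) + exp (- l * s j Y)"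
      by (cases "s j Y \<ge> 0") auto
    also have "\<dots> \<le> W Y"
      unfolding W_def using J j(1) by (intro member_le_sum) (auto intro!: add_nonneg_nonneg)
    finally have le: "exp (l * \<bar>s j Y\<bar>) \<le> W Y" .
    then have W0: "W Y > 0" using exp_gt_zero[of "l * \<bar>s j Y\<bar>"] by linarith
    have "l * \<bar>s j Y\<bar> \<le> ln (W Y)" using le W0 by (simp add: ln_ge_iff)
    also have "\<dots> = ln w0 + ln (W Y / w0)" using W0 w0 by (simp add: ln_div)
    also have "\<dots> \<le> ln w0 + (W Y / w0 - 1)" using W0 w0 by (intro add_left_mono ln_le_minus_one) simp
    finally show ?thesis using j(2) K by (simp add: field_simps)
  qed
  have "(\<integral>Y. (MAX j\<in>J. \<bar>s j Y\<bar>) \<partial>?R) \<le> (\<integral>Y. (ln w0 + W Y / w0 - 1) / l \<partial>?R)"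
    using pt sint Wint by (intro integral_mono integrable_MAX J) auto
  also have "\<dots> = (ln w0 + (\<integral>Y. W Y \<partial>?R) / w0 - 1) / l"
    using Wint by (simp add: R.prob_space)
  also have "\<dots> \<le> ln w0 / l"
    using EW w0 K by (intro divide_right_mono) (auto simp: field_simps)
  also have "ln w0 = ln (2 * real (card J)) + real (card I) * v"
    using J1 by (simp add: w0_def ln_mult)
  finally show "(\<integral>Y. (MAX j\<in>J. \<bar>\<Sum>i\<in>I. case Y i of (x, e) \<Rightarrow> e * Z j x\<bar>) \<partial>?R)
    \<le> (ln (2 * real (card J)) + real (card I) * (l\<^sup>2 * \<sigma>\<^sup>2 / (2 * (1 - l * K)))) / l"
    by (simp add: s_def v_def)
qed

lemma bernstein_maximal:
  fixes Z :: "'j \<Rightarrow> 'a \<Rightarrow> real"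
  assumes J: "finite J" "J \<noteq> {}" and I: "finite I" "I \<noteq> {}"
    and Z: "\<And>j. j \<in> J \<Longrightarrow> bernstein M (Z j) \<sigma> K" and K: "K \<ge> 0" "\<sigma> > 0"
  shows "integrable (PiM I (\<lambda>_. signed)) (\<lambda>Y. MAX j\<in>J. \<bar>\<Sum>i\<in>I. case Y i of (x, e) \<Rightarrow> e * Z j x\<bar>)" (is ?int)
    and "(\<integral>Y. (MAX j\<in>J. \<bar>\<Sum>i\<in>I. case Y i of (x, e) \<Rightarrow> e * Z j x\<bar>) \<partial>PiM I (\<lambda>_. signed))
    \<le> real (card I) * delta_n (card I) (card J) \<sigma> K" (is ?le)
proof -
  define n where "n = real (card I)"
  define L where "L = ln (2 * real (card J))"
  have n: "n > 0" using I by (simp add: n_def card_gt_0_iff)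
  have "card J \<ge> 1" using J by (simp add: Suc_leI card_gt_0_iff)
  then have L: "L > 0" by (simp add: L_def)
  \<comment> \<open>\<open>1 / q\<close> is the square root in \<open>delta_n\<close>. In terms of
    \<open>q\<close>, the variance summand \<open>n * \<sigma> / (2 * q)\<close> becomes
    \<open>L * \<sigma> * q\<close>, equal to the \<open>\<sigma>\<close> part of
    \<open>L / l\<close>.\<close>
  define q where "q = sqrt (n / (2 * L))"
  have q: "q > 0" using n L by (simp add: q_def)
  have q2: "n = 2 * L * q\<^sup>2" using n L by (simp add: q_def)
  have r: "sqrt (2 * L / n) = 1 / q"
    using n L by (simp add: q_def real_sqrt_divide)
  \<comment> \<open>the optimal parameter, for which the two summands of the bound combine to \<open>delta_n\<close>\<close>
  define l where "l = 1 / (K + \<sigma> * q)"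
  have pos: "K + \<sigma> * q > 0" using K q by (intro add_nonneg_pos) auto
  have l: "l > 0" "l * K < 1" using K q pos by (auto simp: l_def)
  have 1: "1 - l * K = l * \<sigma> * q" using pos by (simp add: l_def field_simps)
  note aux = bernstein_maximal_aux[OF J I(1) Z K(1) l]
  show ?int by (rule aux(1)) simp
  have "(L + n * (l\<^sup>2 * \<sigma>\<^sup>2 / (2 * (1 - l * K)))) / l = L / l + n * \<sigma> / (2 * q)"
    unfolding 1 using l K q by (simp add: field_simps power2_eq_square)
  also have "\<dots> = L * (K + \<sigma> * q) + L * \<sigma> * q"
    using q by (simp add: q2 l_def power2_eq_square)
  also have "\<dots> = n * (\<sigma> * (1 / q) + K * (L / n))"
    using n q by (simp add: field_simps) (simp add: q2 power2_eq_square algebra_simps)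
  also have "\<dots> = n * delta_n (card I) (card J) \<sigma> K"
    unfolding r[symmetric] by (simp add: delta_n_def L_def n_def)
  finally show ?le using aux(2) by (simp add: L_def n_def)
qed

end

section \<open>Lower tails of truncated quadratic forms\<close>

text \<open>The truncated square is the square of \<open>min \<bar>x\<bar> K\<close>, which is
  1-Lipschitz with values in [0, K]; factoring the difference of squares gives the constant
  \<open>2 * K\<close>. The right-hand side has the form that the contraction step expects, with
  \<open>h\<close> linear in the direction.\<close>

lemma truncated_square_lipschitz:
  fixes a b K :: real
  assumes "K \<ge> 0"
  shows "\<bar>min (a\<^sup>2) (K\<^sup>2) - min (b\<^sup>2) (K\<^sup>2)\<bar> \<le> \<bar>2 * K * a - 2 * K * b\<bar>"
proof -
  have sq: "min (x\<^sup>2) (K\<^sup>2) = (min \<bar>x\<bar> K)\<^sup>2" for x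
    using assms abs_le_square_iff[of x K] by (auto simp: min_def)
  have "\<bar>min (a\<^sup>2) (K\<^sup>2) - min (b\<^sup>2) (K\<^sup>2)\<bar> = \<bar>min \<bar>a\<bar> K - min \<bar>b\<bar> K\<bar> * \<bar>min \<bar>a\<bar> K + min \<bar>b\<bar> K\<bar>"
    unfolding sq abs_mult[symmetric] by (simp add: power2_eq_square algebra_simps)
  also have "\<dots> \<le> \<bar>a - b\<bar> * (2 * K)"
    using assms by (intro mult_mono) auto
  also have "\<dots> = \<bar>2 * K * a - 2 * K * b\<bar>"
    using assms by (simp add: abs_mult flip: right_diff_distrib)
  finally show ?thesis .
qed

lemma abs_inner_le_l1_MAX:
  fixes u y :: "real ^ 'p::finite"
  shows "\<bar>y \<bullet> u\<bar> \<le> l1_norm u * (MAX j\<in>UNIV. \<bar>y $ j\<bar>)"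
proof -
  have "\<bar>y \<bullet> u\<bar> \<le> (\<Sum>j\<in>UNIV. \<bar>y $ j\<bar> * \<bar>u $ j\<bar>)"
    unfolding inner_vec_def by (rule order_trans[OF sum_abs]) (simp add: abs_mult)
  also have "\<dots> \<le> (\<Sum>j\<in>UNIV. (MAX j\<in>UNIV. \<bar>y $ j\<bar>) * \<bar>u $ j\<bar>)"
    by (intro sum_mono mult_right_mono Max_ge) auto
  finally show ?thesis
    by (simp add: l1_norm_def sum_distrib_left sum_distrib_right mult.commute)
qed

context prob_space
begin

text \<open>The constant 4 is the 2 from symmetrisation times the 2 from the Lipschitz constant
  \<open>2 * K\<close>. After contraction the process is linear in \<open>u\<close>, so Hoelder's
  inequality replaces the maximum over \<open>T\<close> by \<open>R\<close> times a maximum over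
  coordinates, and the bound does not involve the size of \<open>T\<close>.\<close>

lemma expectation_MAX_truncated_squares:
  fixes T :: "(real ^ 'p::finite) set" and V :: "'a \<Rightarrow> real ^ 'p"
  assumes T: "finite T" "T \<noteq> {}" and I: "finite I" "I \<noteq> {}"
    and l1: "\<And>u. u \<in> T \<Longrightarrow> l1_norm u \<le> R"
    and bern: "\<And>j. bernstein M (\<lambda>x. V x $ j) \<sigma> \<kappa>" and pos: "\<sigma> > 0" "\<kappa> \<ge> 0" "K \<ge> 0"
  shows "(\<integral>X. (MAX u\<in>T. \<Sum>i\<in>I. (\<integral>y. min ((V y \<bullet> u)\<^sup>2) (K\<^sup>2) \<partial>M) - min ((V (X i) \<bullet> u)\<^sup>2) (K\<^sup>2)) \<partial>PiM I (\<lambda>_. M))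
    \<le> 4 * K * R * (real (card I) * delta_n (card I) CARD('p) \<sigma> \<kappa>)"
proof -
  interpret S: prob_space signed by (rule prob_space_signed)
  have Vj: "integrable M (\<lambda>x. V x $ j)" for j
    by (rule bernstein_integrable[OF bern])
  have Vu: "integrable M (\<lambda>x. V x \<bullet> u)" for u
    unfolding inner_vec_def using Vj by simp
  have [measurable]: "(\<lambda>x. V x \<bullet> u) \<in> borel_measurable M" for u using Vu by simp
  let ?f = "\<lambda>u x. min ((V x \<bullet> u)\<^sup>2) (K\<^sup>2)" and ?h = "\<lambda>u x. 2 * K * (V x \<bullet> u)"
  have fint: "integrable M (?f u)" for u
    by (intro integrable_const_bound[where B="K\<^sup>2"]) auto
  have hint: "integrable M (?h u)" for u using Vu by simp
  let ?MX = "\<lambda>Y. MAX j\<in>UNIV. \<bar>\<Sum>i\<in>I. case Y i of (x, e) \<Rightarrow> e * V x $ j\<bar>"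
  have mi: "integrable (PiM I (\<lambda>_. signed)) ?MX"
    and mle: "(\<integral>Y. ?MX Y \<partial>PiM I (\<lambda>_. signed)) \<le> real (card I) * delta_n (card I) CARD('p) \<sigma> \<kappa>"
    using bernstein_maximal[of "UNIV :: 'p set" I "\<lambda>j x. V x $ j" \<sigma> \<kappa>] I bern pos by auto
  have R0: "R \<ge> 0"
    using T l1 order_trans[of 0 "l1_norm _"] by (fastforce simp: l1_norm_def sum_nonneg)
  have "(\<integral>X. (MAX u\<in>T. 0 + (\<Sum>i\<in>I. (\<integral>y. ?f u y \<partial>M) - ?f u (X i))) \<partial>PiM I (\<lambda>_. M))
    \<le> (\<integral>Y. (MAX u\<in>T. 0 + (\<Sum>i\<in>I. 2 * (case Y i of (x, e) \<Rightarrow> e * ?h u x))) \<partial>PiM I (\<lambda>_. signed))"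
    by (rule symmetrise_contract_PiM[OF T I(1)]) (rule fint hint truncated_square_lipschitz[OF pos(3)])+
  also have "\<dots> \<le> (\<integral>Y. 4 * K * R * ?MX Y \<partial>PiM I (\<lambda>_. signed))"
  proof (rule integral_mono)
    show "integrable (PiM I (\<lambda>_. signed)) (\<lambda>Y. MAX u\<in>T. 0 + (\<Sum>i\<in>I. 2 * (case Y i of (x, e) \<Rightarrow> e * ?h u x)))"
      unfolding add_0_left
      by (intro integrable_MAX T Bochner_Integration.integrable_sum integrable_mult_right
          S.integrable_PiM_component[where f="\<lambda>p. case p of (x, e) \<Rightarrow> e * _ x"] integrable_signed hint)
    show "integrable (PiM I (\<lambda>_. signed)) (\<lambda>Y. 4 * K * R * ?MX Y)" using mi by simp
    fix Y :: "_ \<Rightarrow> 'a \<times> real"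
    define y :: "real ^ 'p" where "y = (\<Sum>i\<in>I. snd (Y i) *\<^sub>R V (fst (Y i)))"
    have "(\<Sum>i\<in>I. 2 * (case Y i of (x, e) \<Rightarrow> e * ?h u x)) = 4 * K * (y \<bullet> u)" for u
      by (simp add: y_def inner_sum_left case_prod_beta' sum_distrib_left mult_ac)
    moreover have "y \<bullet> u \<le> R * ?MX Y" if "u \<in> T" for u
    proof -
      have MX: "?MX Y = (MAX j\<in>UNIV. \<bar>y $ j\<bar>)"
        by (simp add: y_def case_prod_beta')
      have "0 \<le> ?MX Y" unfolding MX
        by (rule order_trans[OF abs_ge_zero Max_ge]) auto
      then show ?thesis
        using abs_inner_le_l1_MAX[of y u] mult_right_mono[OF l1[OF that], of "?MX Y"]
        unfolding MX by linarith
    qed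
    ultimately have "(\<Sum>i\<in>I. 2 * (case Y i of (x, e) \<Rightarrow> e * ?h u x)) \<le> 4 * K * R * ?MX Y" if "u \<in> T" for u
      using that pos(3) mult_left_mono[of "y \<bullet> u" "R * ?MX Y" "4 * K"] by (simp add: mult_ac)
    then show "(MAX u\<in>T. 0 + (\<Sum>i\<in>I. 2 * (case Y i of (x, e) \<Rightarrow> e * ?h u x))) \<le> 4 * K * R * ?MX Y"
      using T by (subst Max_le_iff) auto
  qed
  also have "\<dots> \<le> 4 * K * R * (real (card I) * delta_n (card I) CARD('p) \<sigma> \<kappa>)"
    using mle pos R0 by (auto intro!: mult_left_mono)
  finally show ?thesis by simp
qed

text \<open>Markov's inequality for the exponential of the largest deviation. The mean of that
  deviation contributes \<open>4 * K * R\<close> times \<open>delta_n\<close>; the variance and the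
  confidence level contribute \<open>K * sqrt (t / card I)\<close> each.\<close>

lemma truncated_squares_lower_tail:
  fixes T :: "(real ^ 'p::finite) set" and V :: "'a \<Rightarrow> real ^ 'p"
  assumes T: "finite T" "T \<noteq> {}" and I: "finite I" "I \<noteq> {}"
    and l1: "\<And>u. u \<in> T \<Longrightarrow> l1_norm u \<le> R"
    and sec: "\<And>u. u \<in> T \<Longrightarrow> integrable M (\<lambda>x. (V x \<bullet> u)\<^sup>2) \<and> (\<integral>x. (V x \<bullet> u)\<^sup>2 \<partial>M) \<le> 1"
    and bern: "\<And>j. bernstein M (\<lambda>x. V x $ j) \<sigma> \<kappa>" and pos: "\<sigma> > 0" "\<kappa> \<ge> 0" "K > 0" "t > 0"
    and small: "K * sqrt (t / card I) \<le> 1"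
  shows "measure (PiM I (\<lambda>_. M)) {X \<in> space (PiM I (\<lambda>_. M)). \<exists>u\<in>T.
      (\<Sum>i\<in>I. min ((V (X i) \<bullet> u)\<^sup>2) (K\<^sup>2)) / card I
        \<le> (\<integral>x. min ((V x \<bullet> u)\<^sup>2) (K\<^sup>2) \<partial>M) - (4 * K * R * delta_n (card I) CARD('p) \<sigma> \<kappa> + 2 * K * sqrt (t / card I))}
    \<le> exp (- t)"
proof -
  let ?Q = "PiM I (\<lambda>_. M)"
  interpret Q: prob_space ?Q by (rule prob_space_PiM_const)
  have [measurable]: "(\<lambda>x. V x \<bullet> u) \<in> borel_measurable M" for u
    unfolding inner_vec_def using bernstein_integrable[OF bern]
    by (intro borel_measurable_integrable Bochner_Integration.integrable_sum) simp
  define f where "f u x = min ((V x \<bullet> u)\<^sup>2) (K\<^sup>2)" for u x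
  have [measurable]: "f u \<in> borel_measurable M" for u unfolding f_def by measurable
  have f0: "0 \<le> f u x" "f u x \<le> K\<^sup>2" "f u x \<le> (V x \<bullet> u)\<^sup>2" for u x by (auto simp: f_def)
  have fint: "integrable M (f u)" for u
    using f0 by (intro integrable_const_bound[where B="K\<^sup>2"]) auto
  define n where "n = real (card I)"
  have n: "n > 0" using I by (simp add: n_def card_gt_0_iff)
  define \<delta> where "\<delta> = delta_n (card I) CARD('p) \<sigma> \<kappa>"
  \<comment> \<open>This choice balances the variance cost \<open>l * K\<^sup>2\<close> against the
    confidence cost \<open>t / (l * n)\<close>. The assumption \<open>small\<close> says exactly
    that \<open>l * K\<^sup>2 \<le> 1\<close>, so that the scaled functions take values in
    [0, 1].\<close>
  define l where "l = sqrt (t / n) / K"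
  have l: "l > 0" using pos n by (simp add: l_def)
  have lK: "l * K\<^sup>2 = K * sqrt (t / n)" using pos by (simp add: l_def power2_eq_square)
  have tl: "t / (l * n) = K * sqrt (t / n)"
    using pos n by (simp add: l_def real_sqrt_divide field_simps)
  define Z where "Z X = (MAX u\<in>T. \<Sum>i\<in>I. (\<integral>y. f u y \<partial>M) - f u (X i))" for X
  \<comment> \<open>The factor \<open>l\<close> moves inside the maximum, and the \<open>n\<close>
    equal means become the offset in \<open>exp_MAX_sum_le\<close>.\<close>
  have lZ: "l * Z X = (MAX u\<in>T. l * n * (\<integral>y. f u y \<partial>M) - (\<Sum>i\<in>I. l * f u (X i)))" for X
  proof -
    have "mono (\<lambda>x. l * x)" using l by (simp add: mono_def)
    then have "l * Z X = Max ((\<lambda>x. l * x) ` (\<lambda>u. \<Sum>i\<in>I. (\<integral>y. f u y \<partial>M) - f u (X i)) ` T)"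
      unfolding Z_def using T by (intro mono_Max_commute) auto
    then show ?thesis
      by (simp add: image_image n_def sum_subtractf sum_distrib_left algebra_simps)
  qed
  have Z_int: "integrable ?Q Z"
    unfolding Z_def
    by (intro integrable_MAX T Bochner_Integration.integrable_sum Bochner_Integration.integrable_diff
        integrable_PiM_component fint) auto
  have ZB: "Z X \<le> n * K\<^sup>2" for X
  proof -
    have "(\<integral>y. f u y \<partial>M) - f u x \<le> K\<^sup>2" for u x
    proof -
      have "(\<integral>y. f u y \<partial>M) \<le> (\<integral>y. K\<^sup>2 \<partial>M)" using fint f0 by (intro integral_mono) auto
      then show ?thesis using f0(1)[of u x] by (simp add: prob_space)
    qed
    then have "(\<Sum>i\<in>I. (\<integral>y. f u y \<partial>M) - f u (X i)) \<le> (\<Sum>i\<in>I. K\<^sup>2)" for u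
      by (intro sum_mono)
    then show ?thesis unfolding Z_def using T by (subst Max_le_iff) (auto simp: n_def)
  qed
  have [measurable]: "Z \<in> borel_measurable ?Q" using Z_int by simp
  have eint: "integrable ?Q (\<lambda>X. exp (l * Z X))"
    using ZB l by (intro Q.integrable_const_bound[where B="exp (l * (n * K\<^sup>2))"]) auto
  have "(\<integral>X. exp (l * Z X) \<partial>?Q) \<le> exp (n * (l\<^sup>2 * K\<^sup>2) + (\<integral>X. l * Z X \<partial>?Q))"
    unfolding lZ n_def
  proof (rule exp_MAX_sum_le[OF T I(1)])
    fix u assume u: "u \<in> T"
    show "(\<lambda>x. l * f u x) \<in> borel_measurable M" by measurable
    have "l * f u x \<le> 1" for x
      using mult_left_mono[OF f0(2)[of u x], of l] l small lK by (simp add: n_def)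
    then show "0 \<le> l * f u x \<and> l * f u x \<le> 1" for x
      using l f0(1)[of u x] by simp
    \<comment> \<open>One factor \<open>f u x\<close> is bounded by \<open>K\<^sup>2\<close>, the
      other by the untruncated square, whose mean is at most 1.\<close>
    have "(l * f u x)\<^sup>2 \<le> l\<^sup>2 * K\<^sup>2 * (V x \<bullet> u)\<^sup>2" for x
      using mult_mono[OF f0(2) f0(3) _ f0(1), of u x] l
      by (simp add: power2_eq_square mult_ac)
    then have "(\<integral>x. (l * f u x)\<^sup>2 \<partial>M) \<le> (\<integral>x. l\<^sup>2 * K\<^sup>2 * (V x \<bullet> u)\<^sup>2 \<partial>M)"
      using sec[OF u] f0
      by (intro integral_mono' ) auto
    also have "\<dots> \<le> l\<^sup>2 * K\<^sup>2"
      using sec[OF u] mult_left_mono[of "\<integral>x. (V x \<bullet> u)\<^sup>2 \<partial>M" 1 "l\<^sup>2 * K\<^sup>2"] by simp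
    finally show "(\<integral>x. (l * f u x)\<^sup>2 \<partial>M) \<le> l\<^sup>2 * K\<^sup>2" .
  qed
  also have "(\<integral>X. l * Z X \<partial>?Q) \<le> l * (4 * K * R * (n * \<delta>))"
    using expectation_MAX_truncated_squares[OF T I l1 bern pos(1,2), of K] pos l
    by (simp add: Z_def f_def n_def \<delta>_def)
  finally have mgf: "(\<integral>X. exp (l * Z X) \<partial>?Q) \<le> exp (n * (l\<^sup>2 * K\<^sup>2) + l * (4 * K * R * (n * \<delta>)))" by simp
  define r where "r = 4 * K * R * \<delta> + 2 * K * sqrt (t / n)"
  have lnr: "l * (n * r) = l * (4 * K * R * (n * \<delta>)) + n * (l\<^sup>2 * K\<^sup>2) + t"
  proof -
    have "l * (n * r) = l * (4 * K * R * (n * \<delta>)) + l * n * (K * sqrt (t / n)) + l * n * (K * sqrt (t / n))"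
      by (simp add: r_def algebra_simps)
    moreover have "l * n * (K * sqrt (t / n)) = t" unfolding tl[symmetric] using l n by simp
    moreover have "n * (l\<^sup>2 * K\<^sup>2) = l * n * (K * sqrt (t / n))"
      unfolding lK[symmetric] by (simp add: power2_eq_square)
    ultimately show ?thesis by linarith
  qed
  have "measure ?Q {X \<in> space ?Q. exp (l * Z X) \<ge> exp (l * (n * r))} \<le> (\<integral>X. exp (l * Z X) \<partial>?Q) / exp (l * (n * r))"
    using eint by (intro integral_Markov_inequality_measure[where A="{}"]) auto
  also have "\<dots> \<le> exp (n * (l\<^sup>2 * K\<^sup>2) + l * (4 * K * R * (n * \<delta>))) / exp (l * (n * r))"
    using mgf by (intro divide_right_mono) auto
  also have "\<dots> = exp (- t)"
    unfolding lnr by (simp add: exp_diff[symmetric])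
  finally have "measure ?Q {X \<in> space ?Q. exp (l * Z X) \<ge> exp (l * (n * r))} \<le> exp (- t)" .
  moreover have "(\<exists>u\<in>T. (\<Sum>i\<in>I. f u (X i)) / n \<le> (\<integral>x. f u x \<partial>M) - r) \<longleftrightarrow> exp (l * Z X) \<ge> exp (l * (n * r))" for X
  proof -
    have "exp (l * Z X) \<ge> exp (l * (n * r)) \<longleftrightarrow> n * r \<le> Z X" using l by simp
    also have "\<dots> \<longleftrightarrow> (\<exists>u\<in>T. n * r \<le> (\<Sum>i\<in>I. (\<integral>y. f u y \<partial>M) - f u (X i)))"
      unfolding Z_def using T by (subst Max_ge_iff) auto
    also have "\<dots> \<longleftrightarrow> (\<exists>u\<in>T. (\<Sum>i\<in>I. f u (X i)) / n \<le> (\<integral>x. f u x \<partial>M) - r)"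
      using n by (intro bex_cong refl) (auto simp: sum_subtractf n_def[symmetric] field_simps)
    finally show ?thesis by simp
  qed
  ultimately show ?thesis
    by (simp add: f_def r_def n_def \<delta>_def)
qed

text \<open>By continuity the condition on all of \<open>U\<close> is equivalent to the one on a
  countable dense subset, which settles measurability. Enumerating that subset gives a decreasing
  sequence of events with finitely many conditions each, so a lower bound common to all finite
  \<open>T\<close> survives in the limit.\<close>

lemma prob_all_ge_separable:
  fixes Y :: "'u::{metric_space, second_countable_topology} \<Rightarrow> 'a \<Rightarrow> real"
  assumes Y[measurable]: "\<And>u. u \<in> U \<Longrightarrow> Y u \<in> borel_measurable M"
    and cont: "\<And>\<omega>. \<omega> \<in> space M \<Longrightarrow> continuous_on U (\<lambda>u. Y u \<omega>)"
  shows "{\<omega> \<in> space M. \<forall>u\<in>U. c \<le> Y u \<omega>} \<in> sets M"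
    and "U \<noteq> {} \<Longrightarrow> (\<And>T. finite T \<Longrightarrow> T \<noteq> {} \<Longrightarrow> T \<subseteq> U \<Longrightarrow> p \<le> prob {\<omega> \<in> space M. \<forall>u\<in>T. c \<le> Y u \<omega>})
      \<Longrightarrow> p \<le> prob {\<omega> \<in> space M. \<forall>u\<in>U. c \<le> Y u \<omega>}"
proof -
  obtain D where D: "countable D" "D \<subseteq> U" "U \<subseteq> closure D" by (rule separable)
  have eq: "{\<omega> \<in> space M. \<forall>u\<in>U. c \<le> Y u \<omega>} = {\<omega> \<in> space M. \<forall>u\<in>D. c \<le> Y u \<omega>}"
  proof (intro Collect_cong conj_cong refl iffI ballI)
    fix \<omega> u assume \<omega>: "\<omega> \<in> space M" "\<forall>u\<in>D. c \<le> Y u \<omega>" and u: "u \<in> U"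
    from u D(3) have "u \<in> closure D" by blast
    then obtain x where x: "\<And>n. x n \<in> D" "x \<longlonglongrightarrow> u"
      by (auto simp: closure_sequential)
    have "(\<lambda>n. Y (x n) \<omega>) \<longlonglongrightarrow> Y u \<omega>"
      using cont[OF \<omega>(1)] x D(2) u unfolding continuous_on_sequentially by (auto simp: o_def)
    then show "c \<le> Y u \<omega>"
      by (rule LIMSEQ_le_const) (use \<omega>(2) x(1) in auto)
  qed (use D(2) in auto)
  have [measurable]: "Y u \<in> borel_measurable M" if "u \<in> D" for u using that D(2) by auto
  show "{\<omega> \<in> space M. \<forall>u\<in>U. c \<le> Y u \<omega>} \<in> sets M"
    unfolding eq using D(1) by measurable
  assume "U \<noteq> {}" and fin: "\<And>T. finite T \<Longrightarrow> T \<noteq> {} \<Longrightarrow> T \<subseteq> U \<Longrightarrow> p \<le> prob {\<omega> \<in> space M. \<forall>u\<in>T. c \<le> Y u \<omega>}"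
  then have "D \<noteq> {}" using D(3) by auto
  then obtain d :: "nat \<Rightarrow> 'u" where d: "D = range d"
    using D(1) uncountable_def by blast
  define A where "A k = {\<omega> \<in> space M. \<forall>i\<le>k. c \<le> Y (d i) \<omega>}" for k
  have "(\<lambda>k. prob (A k)) \<longlonglongrightarrow> prob (\<Inter>k. A k)"
  proof (rule finite_Lim_measure_decseq)
    show "range A \<subseteq> sets M"
      unfolding A_def using d by auto
    show "decseq A" by (auto simp: decseq_def A_def)
  qed
  moreover have "(\<Inter>k. A k) = {\<omega> \<in> space M. \<forall>u\<in>U. c \<le> Y u \<omega>}"
    unfolding eq d A_def by auto
  moreover have "p \<le> prob (A k)" for k
    using fin[of "d ` {..k}"] d D(2) by (auto simp: A_def atMost_def)
  ultimately show "p \<le> prob {\<omega> \<in> space M. \<forall>u\<in>U. c \<le> Y u \<omega>}"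
    by (metis LIMSEQ_le_const)
qed

end

section \<open>Compatibility constants and restricted eigenvalues\<close>

text \<open>The level \<open>K\<close> minimises \<open>K * \<epsilon> + 2 * C powr m * K powr (2 - m) / (m - 2)\<close>; the last identity
  says that the main term of \<^const>\<open>Delta_L\<close> is twice the minimum.\<close>

lemma optimal_truncation:
  fixes m C \<epsilon> :: real
  assumes "m > 2" "C > 0" "\<epsilon> > 0"
  defines "K \<equiv> (2 * C powr m / \<epsilon>) powr (1 / (m - 1))"
  shows "K > 0" and "2 * C powr m * K powr (2 - m) = K * \<epsilon>"
    and "D_const m C * \<epsilon> powr ((m - 2) / (m - 1)) = 2 * (K * \<epsilon>) * ((m - 1) / (m - 2))"
proof -
  have pos: "2 * C powr m / \<epsilon> > 0" using assms by simp
  show K: "K > 0" using assms by (simp add: K_def)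
  have "K powr (m - 1) = 2 * C powr m / \<epsilon>"
    using assms pos by (simp add: K_def powr_powr)
  then have "2 * C powr m = K powr (m - 1) * \<epsilon>" using assms by (simp add: field_simps)
  then show "2 * C powr m * K powr (2 - m) = K * \<epsilon>"
    using K by (simp add: mult.commute mult.left_commute flip: powr_add)
  have q: "(m - 2) / (m - 1) = 1 - 1 / (m - 1)" "m / (m - 1) = 1 + 1 / (m - 1)"
    using assms by (simp_all add: field_simps)
  have "K * \<epsilon> = 2 powr (1 / (m - 1)) * (C powr m) powr (1 / (m - 1)) * \<epsilon> powr (1 - 1 / (m - 1))"
    using assms by (simp add: K_def powr_divide powr_mult powr_diff)
  moreover have "(2 * C) powr (m / (m - 1)) = 2 * 2 powr (1 / (m - 1)) * (C powr m) powr (1 / (m - 1))"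
    using assms by (simp add: powr_mult powr_powr) (simp add: q(2) powr_add)
  ultimately show "D_const m C * \<epsilon> powr ((m - 2) / (m - 1)) = 2 * (K * \<epsilon>) * ((m - 1) / (m - 2))"
    by (simp add: D_const_def q(1))
qed

section \<open>Quadratic forms of the second moment matrices, and the uniform lower bound\<close>

lemma inner_Sigma_hat:
  fixes A :: "real ^ 'p::finite ^ 'n::finite"
  shows "u \<bullet> (Sigma_hat A *v u) = (\<Sum>i\<in>UNIV. (A $ i \<bullet> u)\<^sup>2) / CARD('n)"
proof -
  have "u \<bullet> (Sigma_hat A *v u) = (1 / CARD('n)) * (u \<bullet> (transpose A *v (A *v u)))"
    by (simp add: Sigma_hat_def scaleR_matrix_vector_assoc[symmetric] matrix_vector_mul_assoc)
  also have "u \<bullet> (transpose A *v (A *v u)) = (A *v u) \<bullet> (A *v u)"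
    by (metis dot_lmul_matrix transpose_matrix_vector inner_commute)
  also have "\<dots> = (\<Sum>i\<in>UNIV. (A $ i \<bullet> u)\<^sup>2)"
    by (simp add: inner_vec_def matrix_vector_mult_def power2_eq_square)
  finally show ?thesis by simp
qed

lemma inner_Sigma0:
  assumes int: "\<And>j k. integrable M (\<lambda>\<omega>. X0 \<omega> $ j * X0 \<omega> $ k)"
  shows "integrable M (\<lambda>\<omega>. (X0 \<omega> \<bullet> u)\<^sup>2)" and "u \<bullet> (Sigma0 M X0 *v u) = (\<integral>\<omega>. (X0 \<omega> \<bullet> u)\<^sup>2 \<partial>M)"
proof -
  have eq: "(X0 \<omega> \<bullet> u)\<^sup>2 = (\<Sum>j\<in>UNIV. \<Sum>k\<in>UNIV. u $ j * u $ k * (X0 \<omega> $ j * X0 \<omega> $ k))" for \<omega>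
    by (simp add: inner_vec_def power2_eq_square sum_product mult_ac)
  show "integrable M (\<lambda>\<omega>. (X0 \<omega> \<bullet> u)\<^sup>2)" unfolding eq using int by simp
  have "(\<integral>\<omega>. (X0 \<omega> \<bullet> u)\<^sup>2 \<partial>M) = (\<Sum>j\<in>UNIV. \<Sum>k\<in>UNIV. u $ j * u $ k * Sigma0 M X0 $ j $ k)"
    unfolding eq using int by (simp add: Sigma0_def)
  then show "u \<bullet> (Sigma0 M X0 *v u) = (\<integral>\<omega>. (X0 \<omega> \<bullet> u)\<^sup>2 \<partial>M)"
    by (simp add: inner_vec_def matrix_vector_mult_def sum_distrib_left mult_ac)
qed

text \<open>Cauchy-Schwarz with weights \<open>\<bar>u $ j\<bar>\<close>, together with the case
  \<open>k = 2\<close> of the Bernstein condition, which bounds second moments by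
  \<open>\<sigma>\<^sup>2\<close>. It serves to show that a direction of unit second moment and l1
  norm at most \<open>R\<close> forces \<open>R * \<sigma> \<ge> 1\<close>.\<close>

lemma bernstein_l2_le_l1:
  fixes X0 :: "'w \<Rightarrow> real ^ 'p::finite"
  assumes bern: "\<And>j. bernstein M (\<lambda>\<omega>. X0 \<omega> $ j) \<sigma> K"
    and int: "integrable M (\<lambda>\<omega>. (X0 \<omega> \<bullet> u)\<^sup>2)"
  shows "(\<integral>\<omega>. (X0 \<omega> \<bullet> u)\<^sup>2 \<partial>M) \<le> (l1_norm u * \<sigma>)\<^sup>2"
proof -
  have X2: "integrable M (\<lambda>\<omega>. (X0 \<omega> $ j)\<^sup>2)" "(\<integral>\<omega>. (X0 \<omega> $ j)\<^sup>2 \<partial>M) \<le> \<sigma>\<^sup>2" for j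
    using bern[of j] unfolding bernstein_def by (auto dest!: spec[of _ 2])
  have "(X0 \<omega> \<bullet> u)\<^sup>2 \<le> l1_norm u * (\<Sum>j\<in>UNIV. \<bar>u $ j\<bar> * (X0 \<omega> $ j)\<^sup>2)" for \<omega>
  proof -
    have sq: "sqrt \<bar>x\<bar> * (sqrt \<bar>x\<bar> * y) = \<bar>x\<bar> * y" for x y :: real
      by (simp flip: mult.assoc)
    have "\<bar>X0 \<omega> \<bullet> u\<bar> \<le> (\<Sum>j\<in>UNIV. sqrt \<bar>u $ j\<bar> * (sqrt \<bar>u $ j\<bar> * \<bar>X0 \<omega> $ j\<bar>))"
      unfolding inner_vec_def sq
      by (rule order_trans[OF sum_abs]) (simp add: abs_mult mult.commute)
    then have "(X0 \<omega> \<bullet> u)\<^sup>2 \<le> (\<Sum>j\<in>UNIV. sqrt \<bar>u $ j\<bar> * (sqrt \<bar>u $ j\<bar> * \<bar>X0 \<omega> $ j\<bar>))\<^sup>2"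
      using power_mono[OF _ abs_ge_zero, of "X0 \<omega> \<bullet> u" _ 2] by simp
    also have "\<dots> \<le> (\<Sum>j\<in>UNIV. (sqrt \<bar>u $ j\<bar>)\<^sup>2) * (\<Sum>j\<in>UNIV. (sqrt \<bar>u $ j\<bar> * \<bar>X0 \<omega> $ j\<bar>)\<^sup>2)"
      by (rule Cauchy_Schwarz_ineq_sum)
    finally show ?thesis by (simp add: l1_norm_def power_mult_distrib)
  qed
  then have "(\<integral>\<omega>. (X0 \<omega> \<bullet> u)\<^sup>2 \<partial>M) \<le> (\<integral>\<omega>. l1_norm u * (\<Sum>j\<in>UNIV. \<bar>u $ j\<bar> * (X0 \<omega> $ j)\<^sup>2) \<partial>M)"
    using int X2 by (intro integral_mono) auto
  also have "\<dots> = l1_norm u * (\<Sum>j\<in>UNIV. \<bar>u $ j\<bar> * (\<integral>\<omega>. (X0 \<omega> $ j)\<^sup>2 \<partial>M))"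
    using X2 by simp
  also have "\<dots> \<le> l1_norm u * (\<Sum>j\<in>UNIV. \<bar>u $ j\<bar> * \<sigma>\<^sup>2)"
    using X2 by (intro mult_left_mono sum_mono) (auto simp: l1_norm_def sum_nonneg)
  also have "\<dots> = (l1_norm u * \<sigma>)\<^sup>2"
    by (simp add: l1_norm_def power2_eq_square sum_distrib_right sum_distrib_left mult_ac)
  finally show ?thesis .
qed

lemma bernstein_distr:
  assumes f: "f \<in> borel_measurable M" and "bernstein M (\<lambda>\<omega>. g (f \<omega>)) \<sigma> K" and g: "g \<in> borel_measurable borel"
  shows "bernstein (distr M borel f) g \<sigma> K"
  using assms by (auto simp: bernstein_def integrable_distr_eq integral_distr)

text \<open>On \<open>U\<close> weak isotropy applies without rescaling, and the l1 bound
  \<open>R\<close> is what the mean of the largest deviation requires. Uniformity over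
  \<open>U\<close> covers the constraint sets of both constants once their elements are
  normalised.\<close>

lemma sample_second_moment_lower:
  fixes M :: "'w measure"
    and X0 :: "'w \<Rightarrow> real ^ 'p::finite"
    and X :: "'w \<Rightarrow> real ^ 'p ^ 'n::finite"
    and m C \<sigma> \<kappa> R t :: real
  assumes ps: "prob_space M"
    and X0[measurable]: "X0 \<in> borel_measurable M"
    and int: "\<And>u. integrable M (\<lambda>\<omega>. (X0 \<omega> \<bullet> u)\<^sup>2)"
    and indep: "prob_space.indep_vars M (\<lambda>_. borel) (\<lambda>i \<omega>. X \<omega> $ i) UNIV"
    and distr: "\<And>i. distr M borel (\<lambda>\<omega>. X \<omega> $ i) = distr M borel X0"
    and m: "m > 2" and C: "C \<ge> 0" and sk: "\<sigma> \<ge> 0" "\<kappa> \<ge> 0"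
    and iso: "weakly_isotropic M X0 m C"
    and bern: "\<And>j. bernstein M (\<lambda>\<omega>. X0 \<omega> $ j) \<sigma> \<kappa>"
    and t: "t > 0"
  defines "U \<equiv> {u. l1_norm u \<le> R \<and> (\<integral>\<omega>. (X0 \<omega> \<bullet> u)\<^sup>2 \<partial>M) = 1}"
    and "\<Delta> \<equiv> Delta_L CARD('n) CARD('p) m C \<sigma> \<kappa> R t"
  shows "{\<omega> \<in> space M. \<forall>u\<in>U. 1 - \<Delta> \<le> u \<bullet> (Sigma_hat (X \<omega>) *v u)} \<in> sets M" (is "?A \<in> _")
    and "measure M {\<omega> \<in> space M. \<forall>u\<in>U. 1 - \<Delta> \<le> u \<bullet> (Sigma_hat (X \<omega>) *v u)} \<ge> 1 - exp (- t) / 2"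
proof -
  interpret prob_space M by (rule ps)
  have Xi[measurable]: "(\<lambda>\<omega>. X \<omega> $ i) \<in> borel_measurable M" for i
    using indep by (auto simp: indep_vars_def)
  define n where "n = real CARD('n)"
  have n: "n > 0" by (simp add: n_def)
  have Ym: "(\<lambda>\<omega>. u \<bullet> (Sigma_hat (X \<omega>) *v u)) \<in> borel_measurable M" for u
    unfolding inner_Sigma_hat by measurable
  have Yc: "continuous_on S (\<lambda>u. u \<bullet> (Sigma_hat (X \<omega>) *v u))" for \<omega> and S :: "(real ^ 'p) set"
    unfolding inner_Sigma_hat by (intro continuous_intros) auto
  show "?A \<in> sets M" by (rule prob_all_ge_separable(1)[OF Ym Yc])
  \<comment> \<open>In the first two cases the event is the whole space. In the third, a direction
    in \<open>U\<close> yields \<open>R * \<sigma> \<ge> 1\<close>, and \<open>\<Delta> < 1\<close>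
    yields the smallness that the exponential bound needs.\<close>
  consider "U = {}" | "\<Delta> \<ge> 1" | "U \<noteq> {}" "\<Delta> < 1" by linarith
  then show "prob ?A \<ge> 1 - exp (- t) / 2"
  proof cases
    case 1
    then have "?A = space M" by auto
    then show ?thesis by (simp add: prob_space)
  next
    case 2
    have "1 - \<Delta> \<le> u \<bullet> (Sigma_hat (X \<omega>) *v u)" for u \<omega>
    proof -
      have "0 \<le> u \<bullet> (Sigma_hat (X \<omega>) *v u)"
        unfolding inner_Sigma_hat by (intro divide_nonneg_nonneg sum_nonneg) auto
      then show ?thesis using 2 by linarith
    qed
    then have "?A = space M" by auto
    then show ?thesis by (simp add: prob_space)
  next
    case 3
    have tail: "\<P>(\<omega> in M. \<bar>X0 \<omega> \<bullet> u\<bar> > s) \<le> (C / s) powr m" if "u \<in> U" "s > 0" for u s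
    proof -
      have "Lnorm M 2 (\<lambda>\<omega>. X0 \<omega> \<bullet> u) = 1"
        using that by (simp add: Lnorm_def U_def)
      then show ?thesis using iso that by (auto simp: weakly_isotropic_def)
    qed
    have trunc: "(\<integral>\<omega>. min ((X0 \<omega> \<bullet> u)\<^sup>2) (K\<^sup>2) \<partial>M) \<ge> 1 - 2 * C powr m * K powr (2 - m) / (m - 2)"
      if "u \<in> U" "K > 0" for u K
      using truncated_second_moment_ge[OF _ int tail m C that(2), of u] that by (simp add: U_def)
    obtain u0 where u0: "u0 \<in> U" using 3 by blast
    \<comment> \<open>With \<open>C = 0\<close> truncation would lose nothing at any level, yet
      truncation at 1/2 caps the unit second moment at 1/4. Positivity lets the optimal level be
      positive.\<close>
    have C0: "C > 0"
    proof (rule ccontr)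
      assume "\<not> C > 0"
      then have "C = 0" using C by simp
      then have "1 \<le> (\<integral>\<omega>. min ((X0 \<omega> \<bullet> u0)\<^sup>2) ((1/2)\<^sup>2) \<partial>M)"
        using trunc[OF u0, of "1/2"] by simp
      also have "\<dots> \<le> (\<integral>\<omega>. (1/2)\<^sup>2 \<partial>M)"
        by (intro integral_mono integrable_const_bound[where B="(1/2)\<^sup>2"]) auto
      finally show False by (simp add: prob_space power2_eq_square)
    qed
    have l1_0: "0 \<le> l1_norm u" for u :: "real ^ 'p" by (simp add: l1_norm_def sum_nonneg)
    have R0: "R \<ge> 0" using u0 l1_0[of u0] by (simp add: U_def)
    \<comment> \<open>as \<open>U\<close> is nonempty, \<open>1 = E (X0 \<bullet> u)\<^sup>2 \<le> (R * \<sigma>)\<^sup>2\<close>; hence \<open>R * \<delta>\<close> absorbs \<open>ln 2\<close> below\<close>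
    have Rs: "R * \<sigma> \<ge> 1"
    proof -
      have "1 \<le> (l1_norm u0 * \<sigma>)\<^sup>2"
        using bernstein_l2_le_l1[OF bern int, of u0] u0 by (simp add: U_def)
      then have "1 \<le> l1_norm u0 * \<sigma>"
        using l1_0[of u0] sk(1) power2_le_imp_le[of 1 "l1_norm u0 * \<sigma>"] by simp
      also have "\<dots> \<le> R * \<sigma>" using u0 sk(1) by (intro mult_right_mono) (auto simp: U_def)
      finally show ?thesis .
    qed
    then have s0: "\<sigma> > 0" using sk(1) by (cases "\<sigma> = 0") auto
    define \<delta> where "\<delta> = delta_n CARD('n) CARD('p) \<sigma> \<kappa>"
    have Rd: "R * \<delta> \<ge> sqrt (2 * ln 2 / n)"
    proof -
      have p1: "real CARD('p) \<ge> 1" using zero_less_card_finite[where 'a='p] by linarith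
      have l0: "0 \<le> ln (2 * real CARD('p))" by (rule ln_ge_zero) (use p1 in linarith)
      then have w0: "0 \<le> 2 * ln (2 * real CARD('p)) / n" using n by simp
      have "sqrt (2 * ln 2 / n) \<le> sqrt (2 * ln (2 * CARD('p)) / n)"
        using n p1 by (intro real_sqrt_le_mono divide_right_mono mult_left_mono) auto
      also have "\<dots> \<le> (R * \<sigma>) * sqrt (2 * ln (2 * CARD('p)) / n)"
        using mult_right_mono[OF Rs real_sqrt_ge_zero[OF w0]] by simp
      also have "\<dots> \<le> R * \<delta>"
        using R0 sk n l0 by (auto simp: \<delta>_def delta_n_def n_def mult.assoc intro!: mult_left_mono)
      finally show ?thesis .
    qed
    have Rd0: "R * \<delta> > 0" using Rd n by (rule_tac less_le_trans[OF _ Rd]) simp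
    define a where "a = sqrt (2 * t / n)"
    have a: "a > 0" using t n by (simp add: a_def)
    define \<epsilon> where "\<epsilon> = 16 * R * \<delta> + a"
    have e: "\<epsilon> > 0" using Rd0 a by (simp add: \<epsilon>_def mult.assoc)
    define K where "K = (2 * C powr m / \<epsilon>) powr (1 / (m - 1))"
    note opt = optimal_truncation[OF m C0 e, folded K_def]
    have K: "K > 0" by (rule opt(1))
    \<comment> \<open>The summand of \<open>Delta_L\<close> with the square of
      \<open>D_const\<close> is nonnegative and is dropped here.\<close>
    have "\<Delta> \<ge> 2 * (K * \<epsilon>) * ((m - 1) / (m - 2))"
      using opt(3) t n by (simp add: \<Delta>_def Delta_L_def \<epsilon>_def a_def n_def \<delta>_def)
    also have "(m - 1) / (m - 2) = 1 + 1 / (m - 2)" using m by (simp add: field_simps)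
    finally have D: "\<Delta> \<ge> 2 * (K * \<epsilon>) + 2 * ((K * \<epsilon>) / (m - 2))"
      by (simp add: algebra_simps)
    have Ke0: "K * \<epsilon> > 0" "(K * \<epsilon>) / (m - 2) > 0" using K e m by auto
    then have Ke: "K * \<epsilon> \<le> 1 / 2" using D 3 by linarith
    \<comment> \<open>the shift by \<open>ln 2\<close> halves the failure probability, for the union bound over two values of \<open>R\<close>\<close>
    define t' where "t' = t + ln 2"
    have t': "t' > 0" using t by (simp add: t'_def add_pos_pos)
    have "sqrt (t' / n) \<le> sqrt (t / n) + sqrt (ln 2 / n)"
      unfolding t'_def add_divide_distrib using t n by (intro sqrt_add_le_add_sqrt) auto
    also have "sqrt (t / n) \<le> a"
      unfolding a_def using t n by (intro real_sqrt_le_mono divide_right_mono) auto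
    also have "sqrt (ln 2 / n) \<le> R * \<delta>"
      using n by (intro order_trans[OF _ Rd] real_sqrt_le_mono divide_right_mono) auto
    finally have "sqrt (t' / n) \<le> a + R * \<delta>" by simp
    then have st': "K * sqrt (t' / n) \<le> K * a + K * (R * \<delta>)"
      using mult_left_mono[of "sqrt (t' / n)" "a + R * \<delta>" K] K by (simp add: algebra_simps)
    have Keq: "K * \<epsilon> = 16 * (K * (R * \<delta>)) + K * a" by (simp add: \<epsilon>_def algebra_simps)
    have KRd: "K * (R * \<delta>) > 0" "K * a > 0" using K Rd0 a by auto
    have small: "K * sqrt (t' / n) \<le> 1" using st' Ke Keq KRd by linarith
    define r where "r = 4 * K * R * \<delta> + 2 * K * sqrt (t' / n)"
    \<comment> \<open>By \<open>st'\<close>, \<open>r\<close> is at most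
      \<open>6 * (K * (R * \<delta>)) + 2 * (K * a)\<close>, while
      \<open>2 * (K * \<epsilon>)\<close> has coefficient 32 on the first product and the same
      second term.\<close>
    have r: "r \<le> 2 * (K * \<epsilon>)" using st' Keq KRd by (simp add: r_def)
    \<comment> \<open>The tail bound lives on a product space. Independence and equal laws identify
      the joint law of the rows with the product of copies of \<open>N\<close>, on which the
      observation map \<open>V\<close> is the identity.\<close>
    define N where "N = distr M borel X0"
    interpret N: prob_space N unfolding N_def by (rule prob_space_distr) simp
    have [simp]: "sets N = sets borel" "space N = UNIV" by (simp_all add: N_def)
    have law: "distr M (PiM UNIV (\<lambda>_::'n. borel)) (\<lambda>\<omega> i. X \<omega> $ i) = PiM UNIV (\<lambda>_::'n. N)"
      using indep unfolding N_def distr[symmetric]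
      by (subst (asm) indep_vars_iff_distr_eq_PiM) (auto simp: distr restrict_UNIV)
    have bernN: "bernstein N (\<lambda>x. x $ j) \<sigma> \<kappa>" for j
      unfolding N_def by (rule bernstein_distr[OF X0 bern]) simp
    have secN: "integrable N (\<lambda>x. (x \<bullet> u)\<^sup>2)" "(\<integral>x. (x \<bullet> u)\<^sup>2 \<partial>N) = (\<integral>\<omega>. (X0 \<omega> \<bullet> u)\<^sup>2 \<partial>M)"
      "(\<integral>x. min ((x \<bullet> u)\<^sup>2) (K\<^sup>2) \<partial>N) = (\<integral>\<omega>. min ((X0 \<omega> \<bullet> u)\<^sup>2) (K\<^sup>2) \<partial>M)" for u
      unfolding N_def using int by (auto simp: integrable_distr_eq integral_distr)
    show ?thesis
    proof (rule prob_all_ge_separable(2)[OF Ym Yc 3(1)])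
      fix T assume T: "finite T" "T \<noteq> {}" "T \<subseteq> U"
      define Bad where "Bad = {x \<in> space (PiM UNIV (\<lambda>_::'n. N)). \<exists>u\<in>T.
        (\<Sum>i\<in>UNIV. min ((x i \<bullet> u)\<^sup>2) (K\<^sup>2)) / n \<le> (\<integral>x. min ((x \<bullet> u)\<^sup>2) (K\<^sup>2) \<partial>N) - r}"
      have "measure (PiM UNIV (\<lambda>_::'n. N)) Bad \<le> exp (- t')"
        unfolding Bad_def r_def \<delta>_def n_def
      proof (rule N.truncated_squares_lower_tail[where V="\<lambda>x. x" and I="UNIV :: 'n set"])
        show "l1_norm u \<le> R" if "u \<in> T" for u using that T(3) by (auto simp: U_def)
        show "integrable N (\<lambda>x. (x \<bullet> u)\<^sup>2) \<and> (\<integral>x. (x \<bullet> u)\<^sup>2 \<partial>N) \<le> 1" if "u \<in> T" for u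
          using that T(3) secN by (auto simp: U_def)
      qed (use T bernN s0 sk(2) K t' small in \<open>auto simp: n_def\<close>)
      moreover have Badm: "Bad \<in> sets (PiM UNIV (\<lambda>_::'n. borel))"
      proof -
        have sN: "sets (PiM UNIV (\<lambda>_::'n. N)) = sets (PiM UNIV (\<lambda>_::'n. borel :: (real ^ 'p) measure))"
          by (intro sets_PiM_cong) auto
        have "Bad = {x \<in> space (PiM UNIV (\<lambda>_::'n. borel)). \<exists>u\<in>T.
          (\<Sum>i\<in>UNIV. min ((x i \<bullet> u)\<^sup>2) (K\<^sup>2)) / n \<le> (\<integral>x. min ((x \<bullet> u)\<^sup>2) (K\<^sup>2) \<partial>N) - r}"
          by (simp add: Bad_def space_PiM)
        also have "\<dots> \<in> sets (PiM UNIV (\<lambda>_::'n. borel))"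
          using T(1) by measurable
        finally show ?thesis .
      qed
      moreover have XP: "(\<lambda>\<omega> i. X \<omega> $ i) \<in> measurable M (PiM UNIV (\<lambda>_::'n. borel))"
        by (rule measurable_PiM_single') (use Xi in auto)
      ultimately have "prob ((\<lambda>\<omega> i. X \<omega> $ i) -` Bad \<inter> space M) \<le> exp (- t')"
        unfolding law[symmetric] by (simp add: measure_distr)
      also have "exp (- t') = exp (- t) / 2"
        using exp_diff[of "- t" "ln 2"] by (simp add: t'_def)
      finally have pb: "prob ((\<lambda>\<omega> i. X \<omega> $ i) -` Bad \<inter> space M) \<le> exp (- t) / 2" .
      have evm: "(\<lambda>\<omega> i. X \<omega> $ i) -` Bad \<inter> space M \<in> sets M"
        by (rule measurable_sets[OF XP Badm])
      have "1 - exp (- t) / 2 \<le> prob (space M - (\<lambda>\<omega> i. X \<omega> $ i) -` Bad \<inter> space M)"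
        using pb prob_compl[OF evm] by linarith
      also have "\<dots> \<le> prob {\<omega> \<in> space M. \<forall>u\<in>T. 1 - \<Delta> \<le> u \<bullet> (Sigma_hat (X \<omega>) *v u)}"
      proof (rule finite_measure_mono)
        show "{\<omega> \<in> space M. \<forall>u\<in>T. 1 - \<Delta> \<le> u \<bullet> (Sigma_hat (X \<omega>) *v u)} \<in> sets M"
          by (rule prob_all_ge_separable(1)[OF Ym Yc])
        show "space M - (\<lambda>\<omega> i. X \<omega> $ i) -` Bad \<inter> space M
          \<subseteq> {\<omega> \<in> space M. \<forall>u\<in>T. 1 - \<Delta> \<le> u \<bullet> (Sigma_hat (X \<omega>) *v u)}"
        proof (intro subsetI CollectI conjI ballI)
          fix \<omega> u assume \<omega>: "\<omega> \<in> space M - (\<lambda>\<omega> i. X \<omega> $ i) -` Bad \<inter> space M" and u: "u \<in> T"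
          then have uU: "u \<in> U" using T by auto
          have "(\<Sum>i\<in>UNIV. min ((X \<omega> $ i \<bullet> u)\<^sup>2) (K\<^sup>2)) / n > (\<integral>x. min ((x \<bullet> u)\<^sup>2) (K\<^sup>2) \<partial>N) - r"
            using \<omega> u by (auto simp: Bad_def space_PiM not_le)
          moreover have "(\<Sum>i\<in>UNIV. min ((X \<omega> $ i \<bullet> u)\<^sup>2) (K\<^sup>2)) / n \<le> u \<bullet> (Sigma_hat (X \<omega>) *v u)"
            unfolding inner_Sigma_hat n_def by (intro divide_right_mono sum_mono) auto
          moreover have "(\<integral>x. min ((x \<bullet> u)\<^sup>2) (K\<^sup>2) \<partial>N) \<ge> 1 - K * \<epsilon> / (m - 2)"
            using trunc[OF uU K] unfolding opt(2) secN(3) .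
          ultimately show "1 - \<Delta> \<le> u \<bullet> (Sigma_hat (X \<omega>) *v u)"
            using D r Ke0 by linarith
        qed auto
      qed
      finally show "1 - exp (- t) / 2 \<le> prob {\<omega> \<in> space M. \<forall>u\<in>T. 1 - \<Delta> \<le> u \<bullet> (Sigma_hat (X \<omega>) *v u)}" .
    qed
  qed
qed

text \<open>Dividing \<open>u\<close> by the root of its theoretical form \<open>a\<close> gives
  unit form and l1 norm at most \<open>R\<close>, since \<open>q \<le> a\<close>. Scaling back gives
  the claim with \<open>a\<close> in place of \<open>q\<close>. Passing to \<open>q\<close> is
  monotone when \<open>1 - \<Delta> \<ge> 0\<close>; otherwise the left side is nonpositive and
  \<open>psd\<close> suffices.\<close>

lemma quadratic_form_lower_scale:
  fixes A B :: "real ^ 'p ^ 'p::finite"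
  assumes good: "\<forall>u\<in>{u. l1_norm u \<le> R \<and> u \<bullet> (A *v u) = 1}. 1 - \<Delta> \<le> u \<bullet> (B *v u)"
    and psd: "0 \<le> u \<bullet> (B *v u)" and q: "q > 0" "q \<le> u \<bullet> (A *v u)" and l1: "l1_norm u \<le> R * sqrt q"
  shows "(1 - \<Delta>) * q \<le> u \<bullet> (B *v u)"
proof -
  define a where "a = u \<bullet> (A *v u)"
  have a: "a > 0" "q \<le> a" using q by (simp_all add: a_def)
  define v where "v = (1 / sqrt a) *\<^sub>R u"
  have scale: "v \<bullet> (C *v v) = (u \<bullet> (C *v u)) / a" for C :: "real ^ 'p ^ 'p"
    using a by (simp add: v_def matrix_vector_mult_scaleR)
  have "0 \<le> l1_norm u" by (simp add: l1_norm_def sum_nonneg)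
  then have "0 \<le> R * sqrt q" using l1 by linarith
  then have "R \<ge> 0" using q(1) by (simp add: zero_le_mult_iff)
  then have "l1_norm u \<le> R * sqrt a"
    using l1 a(2) by (intro order_trans[OF l1] mult_left_mono) auto
  then have "l1_norm v \<le> R"
    using a by (simp add: v_def l1_norm_def abs_mult sum_divide_distrib[symmetric] field_simps)
  moreover have "v \<bullet> (A *v v) = 1" using a scale[of A] by (simp add: a_def)
  ultimately have "1 - \<Delta> \<le> (u \<bullet> (B *v u)) / a" using good scale[of B] by auto
  then have *: "(1 - \<Delta>) * a \<le> u \<bullet> (B *v u)" using a by (simp add: field_simps)
  show ?thesis
  proof (cases "1 - \<Delta> \<ge> 0")
    case True
    then show ?thesis using * mult_left_mono[OF a(2)] by fastforce
  next
    case False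
    then show ?thesis using psd q(1) mult_nonpos_nonneg[of "1 - \<Delta>" q] by linarith
  qed
qed

section \<open>Deterministic lower bounds for the two ratios\<close>

lemma l1_norm_triangle: "l1_norm u \<le> l1_norm v + l1_norm (u - v)"
proof -
  have "l1_norm u \<le> (\<Sum>j\<in>UNIV. \<bar>v $ j\<bar> + \<bar>(u - v) $ j\<bar>)"
    unfolding l1_norm_def vector_minus_component by (intro sum_mono) linarith
  then show ?thesis by (simp add: l1_norm_def sum.distrib)
qed

lemma l1_norm_restrict_le: "l1_norm (vec_restrict u S) \<le> sqrt (card S) * norm (vec_restrict u S)"
proof -
  have "l1_norm (vec_restrict u S) = (\<Sum>j\<in>S. 1 * \<bar>vec_restrict u S $ j\<bar>)"
    unfolding l1_norm_def by (intro sum.mono_neutral_cong_right) (auto simp: vec_restrict_def)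
  also have "\<dots> \<le> L2_set (\<lambda>_. 1) S * L2_set (\<lambda>j. vec_restrict u S $ j) S"
    using L2_set_mult_ineq[of "\<lambda>_. 1" "\<lambda>j. vec_restrict u S $ j" S] by simp
  also have "L2_set (\<lambda>j. vec_restrict u S $ j) S \<le> norm (vec_restrict u S)"
    unfolding norm_vec_def by (simp add: L2_set_def) (intro sum_mono2, auto)
  finally show ?thesis
    by (simp add: L2_set_def mult_left_mono)
qed

text \<open>A minimiser of the empirical problem is feasible for the theoretical one, so its
  theoretical form is at least the squared constant divided by \<open>card S\<close>. Its l1 norm is
  at most \<open>L + 1\<close>. Their quotient after normalisation is the radius in
  \<open>good\<close>; here \<open>sqrt (card S)\<close> stems from the factor \<open>card S\<close>
  in \<open>compat_sq\<close>.\<close>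

lemma compat_ratio_lower:
  fixes A B :: "real ^ 'p ^ 'p::finite"
  assumes S: "S \<noteq> {}" "L \<ge> 0" and pos: "compat_const A L S > 0"
    and psd: "\<And>u. 0 \<le> u \<bullet> (B *v u)"
    and good: "\<forall>u\<in>{u. l1_norm u \<le> (L + 1) * sqrt (card S) / compat_const A L S \<and> u \<bullet> (A *v u) = 1}. 1 - \<Delta> \<le> u \<bullet> (B *v u)"
  shows "(compat_const B L S)\<^sup>2 / (compat_const A L S)\<^sup>2 - 1 \<ge> - \<Delta>"
proof -
  define s where "s = real (card S)"
  have s: "s > 0" using S by (simp add: s_def card_gt_0_iff)
  define \<phi> where "\<phi> = compat_const A L S"
  have \<phi>: "\<phi> > 0" "\<phi>\<^sup>2 = compat_sq A L S" using pos by (auto simp: \<phi>_def compat_const_def)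
  obtain u where u: "u \<in> compat_set L S" "compat_sq B L S = s * (u \<bullet> (B *v u))"
    using compat_sq_attained[OF S, of B] by (auto simp: s_def)
  have "\<phi>\<^sup>2 \<le> s * (u \<bullet> (A *v u))"
    using compat_sq_attained[OF S, of A] u(1) unfolding \<phi>(2) s_def by auto
  then have "\<phi>\<^sup>2 / s \<le> u \<bullet> (A *v u)" using s by (simp add: field_simps)
  moreover have "l1_norm u \<le> 1 + L"
    using l1_norm_triangle[of u "vec_restrict u S"] u(1) by (simp add: compat_set_def)
  then have "l1_norm u \<le> (L + 1) * sqrt (card S) / \<phi> * sqrt (\<phi>\<^sup>2 / s)"
    using \<phi>(1) S by (simp add: real_sqrt_divide s_def)
  ultimately have "(1 - \<Delta>) * (\<phi>\<^sup>2 / s) \<le> u \<bullet> (B *v u)"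
    using \<phi>(1) s by (intro quadratic_form_lower_scale[OF good psd]) (auto simp: \<phi>_def)
  then have "(1 - \<Delta>) * \<phi>\<^sup>2 \<le> compat_sq B L S" using s by (simp add: u(2) field_simps)
  moreover have "compat_sq B L S \<ge> 0" using u(2) s psd[of u] by simp
  ultimately show ?thesis
    using \<phi>(1) unfolding \<phi>_def[symmetric] by (simp add: compat_const_def field_simps)
qed

text \<open>The argument again evaluates both forms at a minimiser of the empirical problem. Now
  \<open>sqrt (card S)\<close> comes from Cauchy-Schwarz on \<open>S\<close>, because the
  normalisation is in the Euclidean norm while the cone condition is in the l1 norm.\<close>

lemma restr_eig_ratio_lower:
  fixes A B :: "real ^ 'p ^ 'p::finite"
  assumes S: "S \<noteq> {}" "L \<ge> 0" and pos: "restr_eig A L S > 0"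
    and psd: "\<And>u. 0 \<le> u \<bullet> (B *v u)"
    and good: "\<forall>u\<in>{u. l1_norm u \<le> (L + 1) * sqrt (card S) / restr_eig A L S \<and> u \<bullet> (A *v u) = 1}. 1 - \<Delta> \<le> u \<bullet> (B *v u)"
  shows "(restr_eig B L S)\<^sup>2 / (restr_eig A L S)\<^sup>2 - 1 \<ge> - \<Delta>"
proof -
  define \<kappa> where "\<kappa> = restr_eig A L S"
  have \<kappa>: "\<kappa> > 0" "\<kappa>\<^sup>2 = re_sq A L S" using pos by (auto simp: \<kappa>_def restr_eig_def)
  obtain u where u: "u \<in> re_set L S" "re_sq B L S = u \<bullet> (B *v u)"
    using re_sq_attained[OF S, of B] by auto
  have "\<kappa>\<^sup>2 \<le> u \<bullet> (A *v u)"
    using re_sq_attained[OF S, of A] u(1) unfolding \<kappa>(2) by auto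
  moreover have "l1_norm u \<le> (L + 1) * sqrt (card S)"
  proof -
    have "l1_norm u \<le> (L + 1) * l1_norm (vec_restrict u S)"
      using l1_norm_triangle[of u "vec_restrict u S"] u(1) by (simp add: re_set_def algebra_simps)
    also have "\<dots> \<le> (L + 1) * sqrt (card S)"
      using l1_norm_restrict_le[of u S] u(1) S(2) by (intro mult_left_mono) (auto simp: re_set_def)
    finally show ?thesis .
  qed
  then have "l1_norm u \<le> (L + 1) * sqrt (card S) / \<kappa> * sqrt (\<kappa>\<^sup>2)"
    using \<kappa>(1) by simp
  ultimately have "(1 - \<Delta>) * \<kappa>\<^sup>2 \<le> re_sq B L S"
    unfolding u(2) using \<kappa>(1) by (intro quadratic_form_lower_scale[OF good psd]) (auto simp: \<kappa>_def)
  moreover have "re_sq B L S \<ge> 0" using u(2) psd[of u] by simp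
  ultimately show ?thesis
    using \<kappa>(1) unfolding \<kappa>_def[symmetric] by (simp add: restr_eig_def field_simps)
qed

text \<open>Outside the sigma-algebra \<open>measure\<close> takes the default value 0, so a lower
  bound on a probability needs its event to be measurable. An infimum is at least \<open>b\<close>
  exactly when all values are, which \<open>prob_all_ge_separable\<close> handles.\<close>

lemma (in prob_space) measurable_INF_quadratic:
  fixes X :: "'a \<Rightarrow> real ^ 'p ^ 'n::finite" and T :: "(real ^ 'p::finite) set"
  assumes X[measurable]: "\<And>i. (\<lambda>\<omega>. X \<omega> $ i) \<in> borel_measurable M" and T: "T \<noteq> {}" and c: "c \<ge> 0"
  shows "(\<lambda>\<omega>. INF u\<in>T. c * (u \<bullet> (Sigma_hat (X \<omega>) *v u))) \<in> borel_measurable M"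
proof (subst borel_measurable_iff_ge, intro allI)
  fix b
  have "bdd_below ((\<lambda>u. c * (u \<bullet> (Sigma_hat (X \<omega>) *v u))) ` T)" for \<omega>
    unfolding inner_Sigma_hat using c
    by (intro bdd_belowI[of _ 0]) (auto intro!: mult_nonneg_nonneg divide_nonneg_nonneg sum_nonneg)
  then have eq: "{\<omega> \<in> space M. b \<le> (INF u\<in>T. c * (u \<bullet> (Sigma_hat (X \<omega>) *v u)))}
    = {\<omega> \<in> space M. \<forall>u\<in>T. b \<le> c * (u \<bullet> (Sigma_hat (X \<omega>) *v u))}"
    using T by (simp add: le_cINF_iff)
  show "{\<omega> \<in> space M. b \<le> (INF u\<in>T. c * (u \<bullet> (Sigma_hat (X \<omega>) *v u)))} \<in> sets M"
    unfolding eq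
  proof (rule prob_all_ge_separable(1))
    show "(\<lambda>\<omega>. c * (u \<bullet> (Sigma_hat (X \<omega>) *v u))) \<in> borel_measurable M" for u
      unfolding inner_Sigma_hat by measurable
    show "continuous_on T (\<lambda>u. c * (u \<bullet> (Sigma_hat (X \<omega>) *v u)))" for \<omega>
      unfolding inner_Sigma_hat by (intro continuous_intros) auto
  qed
qed

theorem theorem4p1:
  fixes M :: "'w measure"
    and X0 :: "'w \<Rightarrow> real ^ 'p::finite"
    and X :: "'w \<Rightarrow> real ^ 'p ^ 'n::finite"
    and S :: "'p set"
    and m C\<^sub>m \<sigma>\<^sub>X K\<^sub>X L :: real
  assumes "prob_space M"
    and "X0 \<in> borel_measurable M"
    and "\<And>j k. integrable M (\<lambda>\<omega>. X0 \<omega> $ j * X0 \<omega> $ k)"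
    and "prob_space.indep_vars M (\<lambda>_. borel) (\<lambda>i \<omega>. X \<omega> $ i) UNIV"
    and "\<And>i. distr M borel (\<lambda>\<omega>. X \<omega> $ i) = distr M borel X0"
    and "m > 2"
    and "C\<^sub>m \<ge> 0" and "\<sigma>\<^sub>X \<ge> 0" and "K\<^sub>X \<ge> 0"
    and "weakly_isotropic M X0 m C\<^sub>m"
    and "\<And>j. bernstein M (\<lambda>\<omega>. X0 \<omega> $ j) \<sigma>\<^sub>X K\<^sub>X"
    and "S \<noteq> {}" and "L \<ge> 0"
    and "compat_const (Sigma0 M X0) L S > 0"
    and "restr_eig (Sigma0 M X0) L S > 0"
  shows "\<forall>t>0. \<P>(\<omega> in M.
      (compat_const (Sigma_hat (X \<omega>)) L S)\<^sup>2 / (compat_const (Sigma0 M X0) L S)\<^sup>2 - 1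
        \<ge> - Delta_L CARD('n) CARD('p) m C\<^sub>m \<sigma>\<^sub>X K\<^sub>X
              ((L + 1) * sqrt (card S) / compat_const (Sigma0 M X0) L S) t \<and>
      (restr_eig (Sigma_hat (X \<omega>)) L S)\<^sup>2 / (restr_eig (Sigma0 M X0) L S)\<^sup>2 - 1
        \<ge> - Delta_L CARD('n) CARD('p) m C\<^sub>m \<sigma>\<^sub>X K\<^sub>X
              ((L + 1) * sqrt (card S) / restr_eig (Sigma0 M X0) L S) t)
      \<ge> 1 - exp (- t)"
proof (intro allI impI)
  fix t :: real assume t: "t > 0"
  interpret prob_space M by (rule assms(1))
  have Xi[measurable]: "(\<lambda>\<omega>. X \<omega> $ i) \<in> borel_measurable M" for i
    using assms(4) by (auto simp: indep_vars_def)
  let ?\<Delta> = "\<lambda>R. Delta_L CARD('n) CARD('p) m C\<^sub>m \<sigma>\<^sub>X K\<^sub>X R t"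
  let ?A = "Sigma0 M X0" and ?B = "\<lambda>\<omega>. Sigma_hat (X \<omega>)"
  \<comment> \<open>The two constants lead to different radii and hence to different values of
    \<open>\<Delta>\<close>. Each gets its own event, and each event fails with probability at most
    \<open>exp (- t) / 2\<close>.\<close>
  define G where "G R = {\<omega> \<in> space M. \<forall>u\<in>{u. l1_norm u \<le> R \<and> u \<bullet> (?A *v u) = 1}. 1 - ?\<Delta> R \<le> u \<bullet> (?B \<omega> *v u)}" for R
  have G: "G R \<in> sets M" "prob (G R) \<ge> 1 - exp (- t) / 2" for R
    using sample_second_moment_lower[OF assms(1,2) inner_Sigma0(1)[OF assms(3)] assms(4-11) t, of R]
    by (simp_all add: G_def inner_Sigma0(2)[OF assms(3)])
  define R1 where "R1 = (L + 1) * sqrt (card S) / compat_const ?A L S"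
  define R2 where "R2 = (L + 1) * sqrt (card S) / restr_eig ?A L S"
  have psd: "0 \<le> u \<bullet> (?B \<omega> *v u)" for u \<omega>
    unfolding inner_Sigma_hat by (intro divide_nonneg_nonneg sum_nonneg) auto
  obtain j where j: "j \<in> S" using assms(12) by blast
  have [measurable]: "(\<lambda>\<omega>. compat_const (?B \<omega>) L S) \<in> borel_measurable M"
    unfolding compat_const_def compat_sq_def
    by (intro measurable_compose[OF _ borel_measurable_sqrt] measurable_INF_quadratic Xi)
       (use axis_mem(1)[OF j assms(13)] in auto)
  have [measurable]: "(\<lambda>\<omega>. restr_eig (?B \<omega>) L S) \<in> borel_measurable M"
    unfolding restr_eig_def re_sq_def
    using measurable_INF_quadratic[OF Xi, of "re_set L S" 1] axis_mem(2)[OF j assms(13)]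
    by (intro measurable_compose[OF _ borel_measurable_sqrt]) auto
  let ?E = "{\<omega> \<in> space M. (compat_const (?B \<omega>) L S)\<^sup>2 / (compat_const ?A L S)\<^sup>2 - 1 \<ge> - ?\<Delta> R1 \<and>
    (restr_eig (?B \<omega>) L S)\<^sup>2 / (restr_eig ?A L S)\<^sup>2 - 1 \<ge> - ?\<Delta> R2}"
  have "prob (space M - G R1 \<inter> G R2) \<le> prob (space M - G R1) + prob (space M - G R2)"
    unfolding Diff_Int using G by (intro measure_Un_le) auto
  then have "1 - exp (- t) \<le> prob (G R1 \<inter> G R2)"
    using prob_compl[OF G(1)[of R1]] prob_compl[OF G(1)[of R2]] G(2)[of R1] G(2)[of R2]
      prob_compl[OF sets.Int[OF G(1)[of R1] G(1)[of R2]]] by linarith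
  also have "\<dots> \<le> prob ?E"
  proof (rule finite_measure_mono)
    show "?E \<in> sets M" by measurable
    show "G R1 \<inter> G R2 \<subseteq> ?E"
    proof
      fix \<omega> assume \<omega>: "\<omega> \<in> G R1 \<inter> G R2"
      have "(compat_const (?B \<omega>) L S)\<^sup>2 / (compat_const ?A L S)\<^sup>2 - 1 \<ge> - ?\<Delta> R1"
        using \<omega> unfolding G_def R1_def
        by (intro compat_ratio_lower[OF assms(12-14) psd]) blast
      moreover have "(restr_eig (?B \<omega>) L S)\<^sup>2 / (restr_eig ?A L S)\<^sup>2 - 1 \<ge> - ?\<Delta> R2"
        using \<omega> unfolding G_def R2_def
        by (intro restr_eig_ratio_lower[OF assms(12,13,15) psd]) blast
      ultimately show "\<omega> \<in> ?E" using \<omega> by (simp add: G_def)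
    qed
  qed
  finally show "1 - exp (- t) \<le> prob {\<omega> \<in> space M.
      (compat_const (?B \<omega>) L S)\<^sup>2 / (compat_const ?A L S)\<^sup>2 - 1
        \<ge> - ?\<Delta> ((L + 1) * sqrt (card S) / compat_const ?A L S) \<and>
      (restr_eig (?B \<omega>) L S)\<^sup>2 / (restr_eig ?A L S)\<^sup>2 - 1
        \<ge> - ?\<Delta> ((L + 1) * sqrt (card S) / restr_eig ?A L S)}"
    unfolding R1_def R2_def .
qed

end
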